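(* Let $n>0$, $x>0$, $y=x^2/(n+x^2)$ and $\zeta=\frac12\delta^2y$ with $\delta>0$. Let the coefficients $c_k$ (depending on $n$ and $y$) be defined by $$\frac{(1+t)^{\frac12n-\frac12}}{1-y(t+1)}=\sum_{k=0}^\infty c_k t^k$$ for small $|t|$. Then $$F_n(x;\delta)\sim\frac{e^{-\frac12(1-y)\delta^2}\sqrt{y}\,(1-y)^{\frac12n}\,\zeta^{\frac12n-1}}{\Gamma\left(\frac12n\right)}\sum_{k=0}^\infty(-1)^k\left(1-\tfrac12n\right)_k\frac{c_k}{\zeta^k},\qquad \zeta\to\infty .$$ The expansion holds for $n=\mathcal O(1)$ and $\varepsilon\le y\le1-\varepsilon$, where $\varepsilon$ is a fixed small positive number; that is, for fixed $n>0$, fixed $\varepsilon\in(0,\frac12)$ and every integer $N\ge0$, as $\zeta\to\infty$ with $\delta>0$ and $y\in[\varepsilon,1-\varepsilon]$, $$F_n(x;\delta)=\frac{e^{-\frac12(1-y)\delta^2}\sqrt{y}\,(1-y)^{\frac12n}\,\zeta^{\frac12n-1}}{\Gamma\left(\frac12n\right)}\left(\sum_{k=0}^{N-1}(-1)^k\left(1-\tfrac12n\right)_k\frac{c_k}{\zeta^k}+\mathcal O\left(\zeta^{-N}\right)\right).$$ When $n=2m$ with $m=1,2,3,\dots$, the terms of the expansion with index $k\ge m$ all vanish.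
   Context: Notation. $(a)_k=\Gamma(a+k)/\Gamma(a)=a(a+1)\cdots(a+k-1)$ is the Pochhammer symbol, $(a)_0=1$. $\operatorname{erfc}(z)=\frac{2}{\sqrt\pi}\int_z^\infty e^{-t^2}dt$. $I_y(a,b)=\frac{1}{B(a,b)}\int_0^y t^{a-1}(1-t)^{b-1}dt$ is the normalized incomplete beta function, with $B(a,b)=\Gamma(a)\Gamma(b)/\Gamma(a+b)$. For $x\ge 0$, $\delta\in\mathbb R$, $n>0$ (not necessarily an integer), with $y=x^2/(n+x^2)$, the noncentral $t$-distribution is $$F_n(x;\delta)=\tfrac12\operatorname{erfc}\left(\delta/\sqrt2\right)+P_n(x;\delta)+Q_n(x;\delta),$$ $$P_n(x;\delta)=\tfrac12 e^{-\frac12\delta^2}\sum_{j=0}^\infty \frac{(\frac12\delta^2)^j}{j!}\, I_y\left(j+\tfrac12,\tfrac12 n\right),\qquad Q_n(x;\delta)=\tfrac12 e^{-\frac12\delta^2}\sum_{j=0}^\infty \frac{\delta}{\sqrt2}\frac{(\frac12\delta^2)^j}{\Gamma(j+\frac32)}\, I_y\left(j+1,\tfrac12 n\right).$$ *)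

theory Defs
  imports "HOL-Analysis.Analysis"
begin

definition erfc :: "real \<Rightarrow> real" where
  "erfc z = 2 / sqrt pi * integral {z..} (\<lambda>t. exp (- t\<^sup>2))"

text \<open>The normalized incomplete beta function \<open>I\<^sub>y(a,b)\<close>, meant for
  \<open>0 \<le> y \<le> 1\<close> and \<open>a, b > 0\<close>.\<close>

definition inc_beta :: "real \<Rightarrow> real \<Rightarrow> real \<Rightarrow> real" where
  "inc_beta y a b =
     1 / Beta a b * integral {0..y} (\<lambda>t. t powr (a - 1) * (1 - t) powr (b - 1))"

definition nct_y :: "real \<Rightarrow> real \<Rightarrow> real" where
  "nct_y n x = x\<^sup>2 / (n + x\<^sup>2)"

definition nct_P :: "real \<Rightarrow> real \<Rightarrow> real \<Rightarrow> real" where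
  "nct_P n x \<delta> = 1 / 2 * exp (- (\<delta>\<^sup>2 / 2)) *
     (\<Sum>j. (\<delta>\<^sup>2 / 2) ^ j / fact j * inc_beta (nct_y n x) (real j + 1 / 2) (n / 2))"

definition nct_Q :: "real \<Rightarrow> real \<Rightarrow> real \<Rightarrow> real" where
  "nct_Q n x \<delta> = 1 / 2 * exp (- (\<delta>\<^sup>2 / 2)) *
     (\<Sum>j. \<delta> / sqrt 2 * ((\<delta>\<^sup>2 / 2) ^ j / Gamma (real j + 3 / 2)) *
          inc_beta (nct_y n x) (real j + 1) (n / 2))"

text \<open>The noncentral \<open>t\<close>-distribution \<open>F\<^sub>n(x;\<delta>)\<close>; this formula is its value for
  \<open>x \<ge> 0\<close> and \<open>n > 0\<close> only.\<close>

definition nct_F :: "real \<Rightarrow> real \<Rightarrow> real \<Rightarrow> real" where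
  "nct_F n x \<delta> = 1 / 2 * erfc (\<delta> / sqrt 2) + nct_P n x \<delta> + nct_Q n x \<delta>"

end

theory Submission
  imports Defs "HOL-Probability.Probability"
begin

text \<open>
  Write \<open>q = n/2\<close>, \<open>s = \<delta>/\<surd>2\<close>, \<open>z = \<surd>\<zeta> = s\<surd>y\<close> and \<open>\<lambda> = 1/y - 1\<close>. With \<open>y\<close> fixed, \<open>P\<^sub>n\<close> and \<open>Q\<^sub>n\<close> are the
  even and odd parts of a single power series in \<open>s\<close>. The recurrence of \<open>I\<^sub>y(a,b)\<close> in \<open>a\<close> makes the
  \<open>z\<close>-derivative of \<open>F\<^sub>n\<close> collapse to \<open>e\<close> to the power \<open>-\<lambda>z\<^sup>2\<close> times
  \<open>M(z) = \<integral>\<^sub>0\<^sup>\<infinity> w\<^bsup>n-1\<^esup> exp(-(w-z)\<^sup>2) dw\<close>, up to a constant factor. Laplace's method gives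
  \<open>M(z) \<sim> \<surd>\<pi> \<Sum>\<^sub>k (-1)\<^sup>k (1-q)\<^sub>k b\<^sub>k z\<^bsup>n-1-2k\<^esup>\<close>, where \<open>b\<^sub>k\<close> is the coefficient of \<open>t\<^sup>k\<close> in
  \<open>(1+t)\<close> to the power \<open>q - 1/2\<close>. The generating function of \<open>c\<^sub>k\<close> says \<open>(1-y) c\<^sub>k - y c\<^bsub>k-1\<^esub> = b\<^sub>k\<close>, so
  the truncated expansion of the theorem has the same derivative as \<open>F\<^sub>n\<close> up to a term of order
  \<open>exp(-\<lambda>z\<^sup>2) z\<^bsup>n-1-2N\<^esup>\<close>. Both functions vanish at infinity, and comparison with a multiple of
  \<open>exp(-\<lambda>z\<^sup>2) z\<^bsup>n-2-2N\<^esup>\<close> bounds their difference, uniformly in \<open>y \<in> [\<epsilon>, 1-\<epsilon>]\<close>.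
\<close>

subsection \<open>The coefficients of the generating function\<close>

text \<open>At t = 0 only the leading coefficient survives, and division by t then shifts the
  sequence. The division excludes t = 0, so the next coefficient is found as the limit of the
  shifted series at 0.\<close>

lemma powser_sums_zero_imp_coeff_zero:
  fixes a :: "nat \<Rightarrow> real"
  assumes r: "0 < r" and s: "\<And>t. \<bar>t\<bar> < r \<Longrightarrow> (\<lambda>k. a k * t ^ k) sums 0"
  shows "a k = 0"
  using s
proof (induction k arbitrary: a)
  case 0
  from 0[of 0] r show ?case by simp
next
  case (Suc k)
  have a0: "a 0 = 0" using Suc.prems[of 0] r by simp
  have *: "(\<lambda>k. a (Suc k) * t ^ k) sums 0" if t: "t \<noteq> 0" "\<bar>t\<bar> < r" for t
  proof -
    have "(\<lambda>k. a (Suc k) * t ^ Suc k) sums 0"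
      using Suc.prems[OF t(2)] a0 by (subst sums_Suc_iff) simp
    from sums_mult[OF this, of "1 / t"] show ?thesis using t by simp
  qed
  have "((\<lambda>t::real. 0) \<longlongrightarrow> a (Suc 0)) (at 0)"
    by (rule powser_limit_0_strong[OF r, where a = "\<lambda>k. a (Suc k)"]) (use * in auto)
  hence "a (Suc 0) = 0" using LIM_unique tendsto_const by (metis LIM_const_eq)
  hence "(\<lambda>k. a (Suc k) * t ^ k) sums 0" if "\<bar>t\<bar> < r" for t
    using * that by (cases "t = 0") auto
  from Suc.IH[OF this] show ?case .
qed

text \<open>Multiply the generating function by 1 - y (1 + t) = (1 - y) - y t and compare
  coefficients with the binomial series. The \<open>case\<close> encodes the convention that the
  coefficient of index -1 is 0.\<close>

lemma quotient_powser_recurrence: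
  fixes c :: "nat \<Rightarrow> real" and a y :: real
  assumes y: "0 < y" "y < 1" and r: "0 < r"
    and c: "\<And>t. \<bar>t\<bar> < r \<Longrightarrow> (\<lambda>k. c k * t ^ k) sums ((1 + t) powr a / (1 - y * (t + 1)))"
  shows "(1 - y) * c k = (a gchoose k) + (case k of 0 \<Rightarrow> 0 | Suc j \<Rightarrow> y * c j)"
proof -
  define d where "d k = (1 - y) * c k - (case k of 0 \<Rightarrow> 0 | Suc j \<Rightarrow> y * c j) - (a gchoose k)" for k
  \<comment> \<open>The three bounds keep t inside the given disc, inside the disc of the binomial
    series, and below the pole at 1/y - 1.\<close>
  define \<rho> where "\<rho> = min r (min 1 (1 / y - 1))"
  have "\<rho> > 0" using r y by (auto simp: \<rho>_def)
  moreover have "(\<lambda>k. d k * t ^ k) sums 0" if t: "\<bar>t\<bar> < \<rho>" for t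
  proof -
    let ?f = "(1 + t) powr a / (1 - y * (t + 1))"
    have "t < 1 / y - 1" using t by (auto simp: \<rho>_def)
    hence nz: "1 - y * (t + 1) > 0" using y by (simp add: field_simps)
    have 1: "(\<lambda>k. (1 - y) * (c k * t ^ k)) sums ((1 - y) * ?f)"
      using t by (intro sums_mult c) (auto simp: \<rho>_def)
    have "(\<lambda>k. y * t * (c k * t ^ k)) sums (y * t * ?f)"
      using t by (intro sums_mult c) (auto simp: \<rho>_def)
    hence "(\<lambda>k. (case Suc k of 0 \<Rightarrow> 0 | Suc j \<Rightarrow> y * c j) * t ^ Suc k) sums (y * t * ?f)"
      by (simp add: mult_ac)
    from sums_Suc[OF this]
    have 2: "(\<lambda>k. (case k of 0 \<Rightarrow> 0 | Suc j \<Rightarrow> y * c j) * t ^ k) sums (y * t * ?f)" by simp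
    have 3: "(\<lambda>k. (a gchoose k) * t ^ k) sums (1 + t) powr a"
      using t by (intro gen_binomial_real) (auto simp: \<rho>_def)
    have "(\<lambda>k. d k * t ^ k) sums ((1 - y) * ?f - y * t * ?f - (1 + t) powr a)"
      using sums_diff[OF sums_diff[OF 1 2] 3] by (simp add: d_def algebra_simps)
    also have "(1 - y) * ?f - y * t * ?f - (1 + t) powr a = (1 - y * (t + 1)) * ?f - (1 + t) powr a"
      by (simp only: left_diff_distrib[symmetric]) (simp add: algebra_simps)
    also have "\<dots> = 0" using nz by simp
    finally show ?thesis .
  qed
  ultimately have "d k = 0" by (rule powser_sums_zero_imp_coeff_zero)
  thus ?thesis by (simp add: d_def)
qed

text \<open>Each step divides by 1 - y \<ge> \<epsilon>, which costs at most a factor 1/\<epsilon>,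
  so the bound passes from k to k + 1. It is the source of the uniformity in y of the final
  error.\<close>

lemma recurrence_uniformly_bounded:
  fixes c :: "real \<Rightarrow> nat \<Rightarrow> real" and \<epsilon> :: real
  assumes \<epsilon>: "0 < \<epsilon>"
    and rec: "\<And>y k. 0 < y \<Longrightarrow> y < 1 \<Longrightarrow>
      (1 - y) * c y k = b k + (case k of 0 \<Rightarrow> 0 | Suc j \<Rightarrow> y * c y j)"
  shows "\<exists>B. \<forall>y. \<epsilon> \<le> y \<and> y \<le> 1 - \<epsilon> \<longrightarrow> \<bar>c y k\<bar> \<le> B"
proof (induction k)
  case 0
  have "\<bar>c y 0\<bar> \<le> \<bar>b 0\<bar> / \<epsilon>" if "\<epsilon> \<le> y" "y \<le> 1 - \<epsilon>" for y
  proof -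
    have "(1 - y) * c y 0 = b 0" using rec[of y 0] that \<epsilon> by simp
    hence "(1 - y) * \<bar>c y 0\<bar> = \<bar>b 0\<bar>" using that \<epsilon> by (simp add: abs_mult flip: \<open>(1 - y) * c y 0 = b 0\<close>)
    moreover have "\<epsilon> * \<bar>c y 0\<bar> \<le> (1 - y) * \<bar>c y 0\<bar>" using that by (intro mult_right_mono) auto
    ultimately show ?thesis using \<epsilon> by (simp add: field_simps)
  qed
  thus ?case by blast
next
  case (Suc k)
  then obtain B where B: "\<And>y. \<epsilon> \<le> y \<Longrightarrow> y \<le> 1 - \<epsilon> \<Longrightarrow> \<bar>c y k\<bar> \<le> B" by blast
  have "\<bar>c y (Suc k)\<bar> \<le> (\<bar>b (Suc k)\<bar> + B) / \<epsilon>" if y: "\<epsilon> \<le> y" "y \<le> 1 - \<epsilon>" for y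
  proof -
    have 1: "(1 - y) * c y (Suc k) = b (Suc k) + y * c y k"
      using rec[of y "Suc k"] y \<epsilon> by simp
    have "\<epsilon> * \<bar>c y (Suc k)\<bar> \<le> (1 - y) * \<bar>c y (Suc k)\<bar>" using y by (intro mult_right_mono) auto
    also have "\<dots> = \<bar>b (Suc k) + y * c y k\<bar>" using y \<epsilon> by (simp add: abs_mult flip: 1)
    also have "\<dots> \<le> \<bar>b (Suc k)\<bar> + y * \<bar>c y k\<bar>"
      using y \<epsilon> by (intro order.trans[OF abs_triangle_ineq]) (simp add: abs_mult)
    also have "y * \<bar>c y k\<bar> \<le> 1 * B" using y \<epsilon> B[OF y] by (intro mult_mono) auto
    finally show ?thesis using \<epsilon> by (simp add: field_simps)
  qed
  thus ?case by blast
qed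

subsection \<open>Moments of a shifted Gaussian on the half-line\<close>

text \<open>Where the function is cut to 0, |v| \<ge> 1/2 makes every lower power at most a multiple
  of |v|^m. Elsewhere the Lagrange remainder contains (1 + t)^(p - m), which is bounded for t > -1/2
  because p \<le> m.\<close>

lemma binomial_Taylor_bound:
  fixes p :: real and m :: nat
  assumes m: "0 < m" "p \<le> real m"
  shows "\<exists>C. \<forall>v. \<bar>(if v > - 1 / 2 then (1 + v) powr p else 0) - (\<Sum>i<m. (p gchoose i) * v ^ i)\<bar>
           \<le> C * \<bar>v\<bar> ^ m"
proof -
  define A where "A = (\<Sum>i<m. \<bar>p gchoose i\<bar> * 2 ^ (m - i))"
  define B where "B = \<bar>p gchoose m\<bar> * (1 / 2) powr (p - real m)"
  have AB: "A \<ge> 0" "B \<ge> 0" by (auto simp: A_def B_def intro!: sum_nonneg)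
  \<comment> \<open>The k-th derivative of (1 + t)^p; the binomial coefficient times k! is the
    falling factorial of p.\<close>
  define diff where "diff k t = (p gchoose k) * fact k * (1 + t) powr (p - real k)" for k :: nat and t :: real
  have D: "DERIV (diff k) t :> diff (Suc k) t" if "t > -1" for k t
  proof -
    have "(p gchoose k) * fact k * (p - real k) = (p gchoose Suc k) * fact (Suc k)"
      using gbinomial_mult_1[of p k] by (simp add: algebra_simps)
    note eq = this
    have "DERIV (diff k) t :> (p gchoose k) * fact k * ((p - real k) * (1 + t) powr (p - real k - 1))"
      unfolding diff_def using that by (auto intro!: derivative_eq_intros)
    also have "(p gchoose k) * fact k * ((p - real k) * (1 + t) powr (p - real k - 1)) = diff (Suc k) t"
      unfolding diff_def eq[symmetric] by (simp add: algebra_simps)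
    finally show ?thesis .
  qed
  have rem: "\<bar>diff m t / fact m * v ^ m\<bar> \<le> B * \<bar>v\<bar> ^ m" if "t > -1/2" for t v
  proof -
    have "(1 + t) powr (p - real m) \<le> (1 / 2) powr (p - real m)"
      using that m by (intro powr_mono2') auto
    thus ?thesis by (auto simp: diff_def B_def abs_mult power_abs intro!: mult_mono mult_right_mono)
  qed
  have "\<bar>(if v > - 1 / 2 then (1 + v) powr p else 0) - (\<Sum>i<m. (p gchoose i) * v ^ i)\<bar>
           \<le> (A + B) * \<bar>v\<bar> ^ m" for v
  proof -
    consider "v \<le> -1/2" | "-1/2 < v" "v < 0" | "v = 0" | "v > 0" by linarith
    thus ?thesis
    proof cases
      case 1
      have "\<bar>\<Sum>i<m. (p gchoose i) * v ^ i\<bar> \<le> (\<Sum>i<m. \<bar>p gchoose i\<bar> * 2 ^ (m - i) * \<bar>v\<bar> ^ m)"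
      proof (intro order.trans[OF sum_abs] sum_mono)
        fix i assume "i \<in> {..<m}"
        hence i: "m = i + (m - i)" by simp
        have "1 \<le> (2 * \<bar>v\<bar>) ^ (m - i)" using 1 by (intro one_le_power) auto
        hence "\<bar>v\<bar> ^ i * 1 \<le> \<bar>v\<bar> ^ i * (2 * \<bar>v\<bar>) ^ (m - i)" by (intro mult_left_mono) auto
        also have "\<dots> = 2 ^ (m - i) * \<bar>v\<bar> ^ m"
          using power_add[of "\<bar>v\<bar>" i "m - i"] i by (simp add: power_mult_distrib mult_ac)
        finally show "\<bar>(p gchoose i) * v ^ i\<bar> \<le> \<bar>p gchoose i\<bar> * 2 ^ (m - i) * \<bar>v\<bar> ^ m"
          by (simp add: abs_mult power_abs mult.assoc mult_left_mono)
      qed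
      also have "\<dots> = A * \<bar>v\<bar> ^ m" by (simp add: A_def sum_distrib_right)
      also have "\<dots> \<le> (A + B) * \<bar>v\<bar> ^ m" using AB by (intro mult_right_mono) auto
      finally show ?thesis using 1 by simp
    next
      case 2
      obtain t where t: "v < t" "t < 0"
        "diff 0 v = (\<Sum>k<m. diff k 0 / fact k * v ^ k) + diff m t / fact m * v ^ m"
        using Maclaurin_minus[of v m diff "diff 0"] 2 m D by force
      have "\<bar>diff m t / fact m * v ^ m\<bar> \<le> B * \<bar>v\<bar> ^ m" using t 2 by (intro rem) auto
      also have "\<dots> \<le> (A + B) * \<bar>v\<bar> ^ m" using AB by (intro mult_right_mono) auto
      finally show ?thesis using t(3) 2 by (simp add: diff_def)
    next
      case 3
      have "(\<Sum>i<m. (p gchoose i) * v ^ i) = (\<Sum>i<m. if i = 0 then 1 else 0)"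
        using 3 by (intro sum.cong) auto
      thus ?thesis using 3 m AB by simp
    next
      case 4
      obtain t where t: "0 < t" "t < v"
        "diff 0 v = (\<Sum>k<m. diff k 0 / fact k * v ^ k) + diff m t / fact m * v ^ m"
        using Maclaurin[of v m diff "diff 0"] 4 m D by force
      have "\<bar>diff m t / fact m * v ^ m\<bar> \<le> B * \<bar>v\<bar> ^ m" using t 4 by (intro rem) auto
      also have "\<dots> \<le> (A + B) * \<bar>v\<bar> ^ m" using AB by (intro mult_right_mono) auto
      finally show ?thesis using t(3) 4 by (simp add: diff_def)
    qed
  qed
  thus ?thesis by blast
qed

lemma has_bochner_integral_lborel_nonneg:
  fixes f :: "real \<Rightarrow> real"
  assumes [measurable]: "f \<in> borel_measurable borel" "S \<in> sets borel"
    and nonneg: "\<And>x. x \<in> S \<Longrightarrow> 0 \<le> f x" and int: "(f has_integral I) S"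
  shows "has_bochner_integral lborel (\<lambda>x. indicator S x * f x) I"
proof (rule has_bochner_integral_nn_integral)
  show "0 \<le> I" using has_integral_nonneg[OF int] nonneg by blast
  show "(\<integral>\<^sup>+ x. ennreal (indicator S x * f x) \<partial>lborel) = ennreal I"
    by (rule nn_integral_has_integral_lebesgue[OF nonneg int])
qed (use nonneg in \<open>auto simp: indicator_def\<close>)

lemma has_bochner_integral_gaussian_moment:
  "has_bochner_integral lborel (\<lambda>u::real. exp (- u\<^sup>2) * u ^ i)
     (if even i then sqrt pi * fact i / (2 ^ i * fact (i div 2)) else 0)"
proof (cases "even i")
  case True
  then obtain k where i: "i = 2 * k" by auto
  show ?thesis using has_bochner_integral_even_function[OF gaussian_moment_even_pos[of k]]
    by (simp add: i)
next
  case False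
  then obtain k where i: "i = 2 * k + 1" by (elim oddE)
  show ?thesis unfolding i using has_bochner_integral_odd_function[OF gaussian_moment_odd_pos[of k]]
    by simp
qed

text \<open>Substitute t = w^2 in Euler's integral for Gamma((r + 1)/2). The endpoint 0 is a null
  set and is dropped beforehand, so that squaring maps the open half-line onto itself.\<close>

lemma has_bochner_integral_powr_gaussian:
  fixes r :: real
  assumes r: "r > -1"
  shows "has_bochner_integral lborel (\<lambda>w. indicator {0<..} w * (w powr r * exp (- w\<^sup>2)))
           (Gamma ((r + 1) / 2) / 2)"
proof -
  define s where "s = (r + 1) / 2"
  define f where "f t = t powr (s - 1) / exp t" for t :: real
  have s: "s > 0" using r by (simp add: s_def)
  have "(f has_integral Gamma s) {0..}" unfolding f_def[abs_def] by (rule Gamma_integral_real[OF s])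
  hence f: "(f has_integral Gamma s) {0<..}"
    by (subst has_integral_spike_set_eq[where T = "{0..}"]) (auto intro: negligible_subset[of "{0}"])
  have img: "(\<lambda>w::real. w\<^sup>2) ` {0<..} = {0<..}"
  proof (intro equalityI subsetI)
    fix x :: real assume "x \<in> {0<..}"
    thus "x \<in> (\<lambda>w. w\<^sup>2) ` {0<..}" by (intro image_eqI[of _ _ "sqrt x"]) auto
  qed auto
  have "(\<lambda>w. \<bar>2 * w\<bar> * f (w\<^sup>2)) absolutely_integrable_on {0<..} \<and>
          integral {0<..} (\<lambda>w. \<bar>2 * w\<bar> * f (w\<^sup>2)) = Gamma s
     \<longleftrightarrow> f absolutely_integrable_on ((\<lambda>w. w\<^sup>2) ` {0<..}) \<and> integral ((\<lambda>w. w\<^sup>2) ` {0<..}) f = Gamma s"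
    by (rule has_absolute_integral_change_of_variables_1')
       (auto intro!: derivative_eq_intros inj_onI simp: power2_eq_iff)
  also have "\<dots>" unfolding img using f
    by (auto simp: integral_unique f_def intro!: nonnegative_absolutely_integrable_1)
  finally have base: "((\<lambda>w. \<bar>2 * w\<bar> * f (w\<^sup>2)) has_integral Gamma s) {0<..}"
    by (metis absolutely_integrable_on_def has_integral_iff)
  have eq: "\<bar>2 * w\<bar> * f (w\<^sup>2) = 2 * (w powr r * exp (- w\<^sup>2))" if "w \<in> {0<..}" for w
  proof -
    have w: "w > 0" using that by simp
    have "(w\<^sup>2) powr (s - 1) = w powr (2 * (s - 1))"
      using w powr_powr[of w 2 "s - 1"] by simp
    also have "2 * (s - 1) = r - 1" by (simp add: s_def)
    finally have "w * (w\<^sup>2) powr (s - 1) = w powr r"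
      using w by (simp add: powr_diff)
    thus ?thesis using w by (simp add: f_def exp_minus field_simps)
  qed
  have "((\<lambda>w. 2 * (w powr r * exp (- w\<^sup>2))) has_integral Gamma s) {0<..}"
    by (rule has_integral_eq[OF eq base])
  from has_integral_mult_right[OF this, of "1/2"]
  have "((\<lambda>w. w powr r * exp (- w\<^sup>2)) has_integral Gamma s / 2) {0<..}" by simp
  thus ?thesis unfolding s_def by (intro has_bochner_integral_lborel_nonneg) auto
qed

text \<open>Up to elementary factors and Gamma(p + 1), this is the parabolic cylinder function D of
  order -p-1 at -sqrt(2) z. A Bochner integral is 0 by default if the integrand is not integrable,
  so integrability is tracked separately.\<close>

definition shifted_gauss_moment :: "real \<Rightarrow> real \<Rightarrow> real" where
  "shifted_gauss_moment p z =
     (LINT w|lborel. indicator {0<..} w * (w powr p * exp (- (w - z)\<^sup>2)))"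

text \<open>Since exp(-(w-z)^2) = exp(-z^2) exp(-w^2) exp(2zw), expanding the last factor and
  integrating term by term leaves moments of the unshifted Gaussian. This matches the power series
  that comes out of differentiating the distribution function.\<close>

lemma shifted_gauss_moment_series:
  fixes p z :: real
  assumes p: "p > -1" and z: "z \<ge> 0"
    and int: "integrable lborel (\<lambda>w. indicator {0<..} w * (w powr p * exp (- (w - z)\<^sup>2)))"
  shows "(\<lambda>k. (2 * z) ^ k / fact k * Gamma ((real k + p + 1) / 2)) sums
           (2 * exp (z\<^sup>2) * shifted_gauss_moment p z)"
proof -
  define f where "f k w = (2 * z) ^ k / fact k * (indicator {0<..} w * (w powr (p + real k) * exp (- w\<^sup>2)))"
    for k :: nat and w :: real
  define a where "a k = (2 * z) ^ k / fact k * (Gamma ((real k + p + 1) / 2) / 2)" for k :: nat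
  have Gpos: "Gamma ((real k + p + 1) / 2) > 0" for k using p by (intro Gamma_real_pos) auto
  have a: "a k \<ge> 0" for k using Gpos[of k] z by (auto simp: a_def intro!: mult_nonneg_nonneg)
  have fm[measurable]: "f k \<in> borel_measurable borel" for k unfolding f_def by measurable
  have f0: "f k w \<ge> 0" for k w using z by (auto simp: f_def indicator_def)
  have fk: "has_bochner_integral lborel (f k) (a k)" for k
    unfolding f_def a_def
    using has_bochner_integral_powr_gaussian[of "p + real k"] p
    by (intro has_bochner_integral_mult_right) (simp add: add_ac)
  have nnf: "(\<integral>\<^sup>+ w. ennreal (f k w) \<partial>lborel) = ennreal (a k)" for k
    using nn_integral_eq_integral[OF integrable.intros[OF fk[of k]]] f0
    by (simp add: has_bochner_integral_integral_eq[OF fk[of k]])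
  define g where "g w = indicator {0<..} w * (w powr p * exp (- (w - z)\<^sup>2))" for w :: real
  have sums: "(\<lambda>k. f k w) sums (exp (z\<^sup>2) * g w)" for w
  proof (cases "w > 0")
    case True
    have "(\<lambda>k. w powr p * exp (- w\<^sup>2) * ((2 * z * w) ^ k /\<^sub>R fact k)) sums
            (w powr p * exp (- w\<^sup>2) * exp (2 * z * w))"
      by (intro sums_mult exp_converges)
    also have "w powr p * exp (- w\<^sup>2) * exp (2 * z * w) = w powr p * exp (- w\<^sup>2 + 2 * z * w)"
      by (simp only: exp_add mult.assoc)
    also have "- w\<^sup>2 + 2 * z * w = z\<^sup>2 + - (w - z)\<^sup>2" by (simp add: power2_eq_square algebra_simps)
    also have "w powr p * exp (z\<^sup>2 + - (w - z)\<^sup>2) = exp (z\<^sup>2) * g w"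
      unfolding exp_add using True by (simp add: g_def)
    also have "(\<lambda>k. w powr p * exp (- w\<^sup>2) * ((2 * z * w) ^ k /\<^sub>R fact k)) = (\<lambda>k. f k w)"
      using True by (simp add: f_def fun_eq_iff powr_add powr_realpow power_mult_distrib divide_inverse mult_ac)
    finally show ?thesis .
  qed (simp add: f_def g_def)
  \<comment> \<open>All terms are nonnegative, so sum and integral commute in the extended reals.
    Summability of \<open>a\<close> over the reals is recovered afterwards from the finiteness of
    the integral.\<close>
  have "(\<Sum>k. ennreal (a k)) = (\<integral>\<^sup>+ w. (\<Sum>k. ennreal (f k w)) \<partial>lborel)"
    by (subst nn_integral_suminf) (auto simp: nnf)
  also have "\<dots> = (\<integral>\<^sup>+ w. ennreal (exp (z\<^sup>2) * g w) \<partial>lborel)"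
    by (intro nn_integral_cong suminf_ennreal_eq f0 sums)
  also have "\<dots> = ennreal (LINT w|lborel. exp (z\<^sup>2) * g w)"
    using int by (intro nn_integral_eq_integral) (auto simp: g_def)
  also have "(LINT w|lborel. exp (z\<^sup>2) * g w) = exp (z\<^sup>2) * shifted_gauss_moment p z"
    by (simp add: shifted_gauss_moment_def g_def)
  finally have S: "(\<Sum>k. ennreal (a k)) = ennreal (exp (z\<^sup>2) * shifted_gauss_moment p z)" .
  hence "summable a" by (intro summable_suminf_not_top a) simp
  moreover have "shifted_gauss_moment p z \<ge> 0"
    unfolding shifted_gauss_moment_def by (intro integral_nonneg_AE) auto
  ultimately have "a sums (exp (z\<^sup>2) * shifted_gauss_moment p z)"
    using S suminf_ennreal2[of a, OF a] suminf_nonneg[of a, OF _ a] by (auto simp: sums_iff)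
  from sums_mult[OF this, of 2] show ?thesis by (simp add: a_def mult_ac)
qed

lemma sum_even_terms:
  "(\<Sum>i<2 * N. if even i then f i else (0 :: real)) = (\<Sum>j<N. f (2 * j))" for N :: nat
  by (induction N) auto

text \<open>The binomial expansion around \<open>w = z\<close> is only used for \<open>w > z/2\<close>; the rest of the integral is
  exponentially small. The condition \<open>p \<le> 2N\<close> makes the Taylor remainder bounded by \<open>(w/z - 1)\<^bsup>2N\<^esup>\<close>
  without any growth factor as \<open>w \<rightarrow> \<infinity>\<close>.\<close>

lemma shifted_gauss_moment_expansion:
  fixes p :: real and N :: nat
  assumes p: "p > -1" and N: "0 < N" "p \<le> 2 * real N"
  shows "\<exists>C. \<forall>z\<ge>1. integrable lborel (\<lambda>w. indicator {0<..} w * (w powr p * exp (- (w - z)\<^sup>2))) \<and>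
     \<bar>shifted_gauss_moment p z -
        sqrt pi * (\<Sum>j<N. (p gchoose (2 * j)) * (fact (2 * j) / (4 ^ j * fact j)) * z powr (p - 2 * real j))\<bar>
     \<le> C * z powr (p - 2 * real N)"
proof -
  \<comment> \<open>With w = z (1 + v), the cutoff v > -1/2 is w > z/2, and u = w - z = z v is the
    variable of the Gaussian moments.\<close>
  define f where "f v = (if v > - 1 / 2 then (1 + v) powr p else 0)" for v :: real
  have [measurable]: "f \<in> borel_measurable borel" unfolding f_def by measurable
  define S where "S v = (\<Sum>i<2 * N. (p gchoose i) * v ^ i)" for v :: real
  have [measurable]: "S \<in> borel_measurable borel" unfolding S_def by measurable
  obtain C where C: "\<And>v. \<bar>f v - S v\<bar> \<le> C * \<bar>v\<bar> ^ (2 * N)"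
    using binomial_Taylor_bound[of "2 * N" p] N unfolding f_def S_def by auto
  define mom where "mom i = (if even i then sqrt pi * fact i / (2 ^ i * fact (i div 2)) else 0)" for i :: nat
  have mom: "has_bochner_integral lborel (\<lambda>u::real. exp (- u\<^sup>2) * u ^ i) (mom i)" for i
    unfolding mom_def by (rule has_bochner_integral_gaussian_moment)
  have mom2: "mom (2 * j) = sqrt pi * (fact (2 * j) / (4 ^ j * fact j))" for j
    by (simp add: mom_def power_mult[of 2 2])
  \<comment> \<open>\<open>D\<close> controls the part w \<le> z/2: exp(-z^2/4) is at most 4^(N+1)
    (N+1)! / z^(2N+2), and 1/(p+1) comes from integrating w^p.\<close>
  define D where "D = 4 ^ (N + 1) * fact (N + 1) / (p + 1)"
  have "integrable lborel (\<lambda>w. indicator {0<..} w * (w powr p * exp (- (w - z)\<^sup>2))) \<and>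
     \<bar>shifted_gauss_moment p z -
        sqrt pi * (\<Sum>j<N. (p gchoose (2 * j)) * (fact (2 * j) / (4 ^ j * fact j)) * z powr (p - 2 * real j))\<bar>
     \<le> (D + C * mom (2 * N)) * z powr (p - 2 * real N)" if z: "z \<ge> 1" for z
  proof -
    let ?\<Sigma> = "\<Sum>j<N. (p gchoose (2 * j)) * (fact (2 * j) / (4 ^ j * fact j)) * (1 / z ^ (2 * j))"
    have "has_bochner_integral lborel (\<lambda>u. \<Sum>i<2 * N. (p gchoose i) / z ^ i * (exp (- u\<^sup>2) * u ^ i))
            (\<Sum>i<2 * N. (p gchoose i) / z ^ i * mom i)"
      by (intro has_bochner_integral_sum has_bochner_integral_mult_right mom)
    also have "(\<lambda>u. \<Sum>i<2 * N. (p gchoose i) / z ^ i * (exp (- u\<^sup>2) * u ^ i)) =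
        (\<lambda>u. exp (- u\<^sup>2) * S (u / z))"
      by (simp add: S_def sum_distrib_left power_divide mult_ac)
    \<comment> \<open>Odd Gaussian moments vanish, so only the even binomial coefficients
      remain.\<close>
    also have "(\<Sum>i<2 * N. (p gchoose i) / z ^ i * mom i) =
        (\<Sum>i<2 * N. if even i then (p gchoose i) / z ^ i * mom i else 0)"
      by (intro sum.cong) (auto simp: mom_def)
    also have "\<dots> = sqrt pi * ?\<Sigma>"
      unfolding sum_even_terms sum_distrib_left mom2
      by (intro sum.cong refl) (simp add: field_simps)
    finally have I_S: "has_bochner_integral lborel (\<lambda>u. exp (- u\<^sup>2) * S (u / z)) (sqrt pi * ?\<Sigma>)" .
    have I_b: "has_bochner_integral lborel (\<lambda>u. C / z ^ (2 * N) * (exp (- u\<^sup>2) * u ^ (2 * N)))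
       (C / z ^ (2 * N) * mom (2 * N))" by (intro has_bochner_integral_mult_right mom)
    have le: "norm (exp (- u\<^sup>2) * (f (u / z) - S (u / z))) \<le> C / z ^ (2 * N) * (exp (- u\<^sup>2) * u ^ (2 * N))" for u
    proof -
      have "exp (- u\<^sup>2) * \<bar>f (u / z) - S (u / z)\<bar> \<le> exp (- u\<^sup>2) * (C * \<bar>u / z\<bar> ^ (2 * N))"
        by (intro mult_left_mono C) auto
      also have "\<bar>u / z\<bar> ^ (2 * N) = u ^ (2 * N) / z ^ (2 * N)"
        by (simp add: power_mult power_divide)
      finally show ?thesis by (simp add: abs_mult mult_ac)
    qed
    have int_d: "integrable lborel (\<lambda>u. exp (- u\<^sup>2) * (f (u / z) - S (u / z)))"
      by (rule Bochner_Integration.integrable_bound[OF integrable.intros[OF I_b]])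
         (measurable, intro AE_I2 order.trans[OF le], simp only: real_norm_def abs_ge_self)
    define J where "J = (LINT u|lborel. exp (- u\<^sup>2) * (f (u / z) - S (u / z)))"
    have "norm J \<le> (LINT u|lborel. C / z ^ (2 * N) * (exp (- u\<^sup>2) * u ^ (2 * N)))"
      unfolding J_def by (rule Bochner_Integration.integral_norm_bound_integral[OF int_d integrable.intros[OF I_b] le])
    hence J: "\<bar>J\<bar> \<le> C * mom (2 * N) / z ^ (2 * N)" using mom[of "2 * N"] by (simp add: has_bochner_integral_iff)
    have "has_bochner_integral lborel (\<lambda>u. exp (- u\<^sup>2) * S (u / z) + exp (- u\<^sup>2) * (f (u / z) - S (u / z)))
        (sqrt pi * ?\<Sigma> + J)"
      using int_d by (intro has_bochner_integral_add I_S) (simp add: has_bochner_integral_iff J_def)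
    hence "has_bochner_integral lborel (\<lambda>u. exp (- u\<^sup>2) * f (u / z)) (sqrt pi * ?\<Sigma> + J)"
      by (simp add: algebra_simps)
    hence "has_bochner_integral lborel (\<lambda>w. exp (- (w - z)\<^sup>2) * f ((w - z) / z)) (sqrt pi * ?\<Sigma> + J)"
      by (subst (asm) lborel_has_bochner_integral_real_affine_iff[where c = 1 and t = "-z"])
         (simp_all add: add.commute)
    hence I2: "has_bochner_integral lborel (\<lambda>w. z powr p * (exp (- (w - z)\<^sup>2) * f ((w - z) / z)))
        (z powr p * (sqrt pi * ?\<Sigma> + J))" by (rule has_bochner_integral_mult_right)
    have Ip: "has_bochner_integral lborel (\<lambda>w. exp (- (z\<^sup>2 / 4)) * (indicator {0..z/2} w * (w powr p)))
        (exp (- (z\<^sup>2 / 4)) * ((z / 2) powr (p + 1) / (p + 1)))"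
      using p z by (intro has_bochner_integral_mult_right has_bochner_integral_lborel_nonneg
            has_integral_powr_from_0) auto
    define h where "h w = indicator {0<..z/2} w * (w powr p * exp (- (w - z)\<^sup>2))" for w :: real
    have [measurable]: "h \<in> borel_measurable borel" unfolding h_def by measurable
    have h0: "h w \<ge> 0" for w by (auto simp: h_def indicator_def)
    have hle: "h w \<le> exp (- (z\<^sup>2 / 4)) * (indicator {0..z/2} w * (w powr p))" for w
    proof (cases "0 < w \<and> w \<le> z / 2")
      case True
      hence "(z / 2)\<^sup>2 \<le> (z - w)\<^sup>2" using z by (intro power_mono) auto
      hence "exp (- (w - z)\<^sup>2) \<le> exp (- (z\<^sup>2 / 4))" by (simp add: power2_commute power_divide)
      thus ?thesis using True by (simp add: h_def mult.commute mult_left_mono)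
    qed (auto simp: h_def indicator_def)
    have int_h: "integrable lborel h"
      by (rule Bochner_Integration.integrable_bound[OF integrable.intros[OF Ip]])
         (measurable, intro AE_I2, simp only: real_norm_def abs_of_nonneg[OF h0] order.trans[OF hle abs_ge_self])
    define H where "H = (LINT w|lborel. h w)"
    have H0: "H \<ge> 0" unfolding H_def using h0 by simp
    have "H \<le> (LINT w|lborel. exp (- (z\<^sup>2 / 4)) * (indicator {0..z/2} w * (w powr p)))"
      unfolding H_def by (intro integral_mono int_h integrable.intros[OF Ip] hle)
    also have "\<dots> = exp (- (z\<^sup>2 / 4)) * ((z / 2) powr (p + 1) / (p + 1))"
      by (rule has_bochner_integral_integral_eq[OF Ip])
    also have "\<dots> \<le> exp (- (z\<^sup>2 / 4)) * (z powr (p + 1) / (p + 1))"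
      using z p by (intro mult_left_mono divide_right_mono powr_mono2) auto
    also have "\<dots> \<le> D * z powr (p - 2 * real N)"
    proof -
      define x where "x = z\<^sup>2 / 4"
      have "x \<ge> 0" by (simp add: x_def)
      hence "x ^ (N + 1) /\<^sub>R fact (N + 1) \<le> exp x"
        using sum_le_suminf[OF summable_exp_generic[of x], of "{N + 1}"]
        unfolding exp_def by (simp del: fact_Suc power_Suc)
      hence "x ^ (N + 1) \<le> fact (N + 1) * exp x"
        by (simp add: divide_simps mult.commute del: fact_Suc power_Suc)
      hence "4 ^ (N + 1) * x ^ (N + 1) * exp (- x) \<le> 4 ^ (N + 1) * (fact (N + 1) * exp x) * exp (- x)"
        by (intro mult_right_mono mult_left_mono) auto
      also have "\<dots> = 4 ^ (N + 1) * fact (N + 1)"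
        by (simp add: exp_minus del: fact_Suc power_Suc)
      also have "4 ^ (N + 1) * x ^ (N + 1) = z ^ (2 * (N + 1))"
        unfolding power_mult power_mult_distrib[symmetric] by (simp add: x_def)
      finally have e: "z ^ (2 * (N + 1)) * exp (- (z\<^sup>2 / 4)) \<le> 4 ^ (N + 1) * fact (N + 1)"
        unfolding x_def .
      \<comment> \<open>The new exponent equals p + 2; raising it is allowed because z \<ge> 1, and
        the surplus power z^(2N+2) is the one absorbed by the exponential.\<close>
      have "z powr (p + 1) \<le> z powr (p - 2 * real N + real (2 * (N + 1)))"
        using z by (intro powr_mono) auto
      also have "\<dots> = z powr (p - 2 * real N) * z ^ (2 * (N + 1))"
        using z by (subst powr_add, subst powr_realpow) auto
      finally have "exp (- (z\<^sup>2 / 4)) * z powr (p + 1) \<le>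
          z powr (p - 2 * real N) * (z ^ (2 * (N + 1)) * exp (- (z\<^sup>2 / 4)))"
        by (simp add: mult_ac)
      also have "\<dots> \<le> z powr (p - 2 * real N) * (4 ^ (N + 1) * fact (N + 1))"
        by (intro mult_left_mono e) auto
      finally show ?thesis using p by (simp add: D_def divide_right_mono mult_ac)
    qed
    finally have H: "H \<le> D * z powr (p - 2 * real N)" .
    have "has_bochner_integral lborel (\<lambda>w. h w + z powr p * (exp (- (w - z)\<^sup>2) * f ((w - z) / z)))
        (H + z powr p * (sqrt pi * ?\<Sigma> + J))"
      using int_h by (intro has_bochner_integral_add I2) (simp add: has_bochner_integral_iff H_def)
    also have "(\<lambda>w. h w + z powr p * (exp (- (w - z)\<^sup>2) * f ((w - z) / z))) =
        (\<lambda>w. indicator {0<..} w * (w powr p * exp (- (w - z)\<^sup>2)))"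
    proof
      fix w :: real
      show "h w + z powr p * (exp (- (w - z)\<^sup>2) * f ((w - z) / z)) =
        indicator {0<..} w * (w powr p * exp (- (w - z)\<^sup>2))"
      proof (cases "w > z / 2")
        case True
        hence "(w - z) / z > - 1 / 2" using z by (simp add: field_simps)
        moreover have "1 + (w - z) / z = w / z" using z by (simp add: field_simps)
        ultimately have "f ((w - z) / z) = w powr p / z powr p"
          using True z by (simp add: f_def powr_divide)
        thus ?thesis using True z by (simp add: h_def)
      next
        case False
        hence "\<not> (w - z) / z > - 1 / 2" using z by (simp add: field_simps)
        hence "f ((w - z) / z) = 0" by (simp add: f_def)
        thus ?thesis using False by (simp add: h_def indicator_def)
      qed
    qed
    finally have I: "has_bochner_integral lborel (\<lambda>w. indicator {0<..} w * (w powr p * exp (- (w - z)\<^sup>2)))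
        (H + z powr p * (sqrt pi * ?\<Sigma> + J))" .
    have eq: "z powr (p - 2 * real j) = z powr p * (1 / z ^ (2 * j))" for j
      using z powr_realpow[of z "2 * j"] by (simp add: powr_diff)
    have J': "\<bar>z powr p * J\<bar> \<le> z powr p * (C * mom (2 * N) / z ^ (2 * N))"
      unfolding abs_mult abs_of_nonneg[OF powr_ge_zero] by (intro mult_left_mono J) simp
    have sumeq: "(\<Sum>j<N. (p gchoose (2 * j)) * (fact (2 * j) / (4 ^ j * fact j)) * z powr (p - 2 * real j))
        = z powr p * ?\<Sigma>"
      unfolding eq sum_distrib_left by (intro sum.cong refl) (simp add: mult_ac)
    have "shifted_gauss_moment p z = H + z powr p * (sqrt pi * ?\<Sigma> + J)"
      unfolding shifted_gauss_moment_def by (rule has_bochner_integral_integral_eq[OF I])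
    hence     "shifted_gauss_moment p z -
        sqrt pi * (\<Sum>j<N. (p gchoose (2 * j)) * (fact (2 * j) / (4 ^ j * fact j)) * z powr (p - 2 * real j))
        = H + z powr p * J"
      unfolding sumeq by (simp add: distrib_left)
    also have "\<bar>\<dots>\<bar> \<le> D * z powr (p - 2 * real N) + z powr p * (C * mom (2 * N) / z ^ (2 * N))"
      using H H0 J' by linarith
    also have "\<dots> = (D + C * mom (2 * N)) * z powr (p - 2 * real N)"
      unfolding eq by (simp add: algebra_simps add_divide_distrib)
    finally show ?thesis using I by (simp add: has_bochner_integral_iff)
  qed
  thus ?thesis by blast
qed

text \<open>Brings the Laplace coefficients into the form of the theorem. Passing from j to j + 1
  adds the factors (2q-2-2j)(2q-1-2j) = 4 (q-1-j)(q-1/2-j): the first extends the signed Pochhammer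
  symbol, the second the binomial coefficient, and the 4 cancels against 4^(j+1).\<close>

lemma gbinomial_double_fact:
  "((2 * q - 1) gchoose (2 * j)) * (fact (2 * j) / (4 ^ j * fact j)) =
     ((q - 1 / 2) gchoose j) * ((- 1) ^ j * pochhammer (1 - q) j)" for q :: real
proof (induction j)
  case (Suc j)
  have 1: "(a gchoose Suc k) * (1 + real k) = (a - real k) * (a gchoose k)" for a :: real and k
    using gbinomial_mult_1[of a k] by (simp add: algebra_simps)
  have "((2 * q - 1) gchoose (2 * Suc j)) * (fact (2 * Suc j) / (4 ^ Suc j * fact (Suc j))) =
    (((2 * q - 1) gchoose Suc (Suc (2 * j))) * (1 + real (Suc (2 * j)))) * (1 + real (2 * j))
     * (fact (2 * j) / (4 ^ j * fact j)) / (4 * (1 + real j))"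
    by (simp add: field_simps)
  also have "\<dots> = (2 * q - 1 - real (Suc (2 * j))) * (((2 * q - 1) gchoose Suc (2 * j)) * (1 + real (2 * j)))
     * (fact (2 * j) / (4 ^ j * fact j)) / (4 * (1 + real j))"
    by (subst 1) (simp add: mult_ac)
  also have "\<dots> = (2 * q - 1 - real (Suc (2 * j))) * (2 * q - 1 - real (2 * j)) *
     (((2 * q - 1) gchoose (2 * j)) * (fact (2 * j) / (4 ^ j * fact j))) / (4 * (1 + real j))"
    by (subst 1) (simp add: mult_ac)
  also have "\<dots> = (q - 1 - real j) * (q - 1 / 2 - real j) *
     (((q - 1 / 2) gchoose j) * ((- 1) ^ j * pochhammer (1 - q) j)) / (1 + real j)"
    unfolding Suc.IH by (simp add: field_simps)
  also have "\<dots> = ((q - 1 / 2 - real j) * ((q - 1 / 2) gchoose j)) / (1 + real j) *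
       ((- 1) ^ Suc j * pochhammer (1 - q) (Suc j))"
    by (simp add: pochhammer_Suc field_simps)
  also have "((q - 1 / 2 - real j) * ((q - 1 / 2) gchoose j)) / (1 + real j) = ((q - 1 / 2) gchoose Suc j)"
    by (subst 1[symmetric]) (simp add: field_simps)
  finally show ?case .
qed auto

lemma integrable_shifted_gauss_moment:
  fixes p z :: real
  assumes "p > -1" "z \<ge> 1"
  shows "integrable lborel (\<lambda>w. indicator {0<..} w * (w powr p * exp (- (w - z)\<^sup>2)))"
proof -
  have "p \<le> 2 * real (Suc (nat \<lceil>p\<rceil>))" using real_nat_ceiling_ge[of p] by simp
  thus ?thesis using shifted_gauss_moment_expansion[of p "Suc (nat \<lceil>p\<rceil>)"] assms by blast
qed

text \<open>Admits every N, also with 2q - 1 > 2N. The expansion is taken up to a large enough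
  \<open>N'\<close>, and the terms from N to \<open>N'\<close> are absorbed into the error, which is
  legitimate for z \<ge> 1.\<close>

lemma shifted_gauss_moment_asymptotics:
  fixes q :: real and N :: nat
  assumes q: "q > 0"
  shows "\<exists>C. \<forall>z\<ge>1. \<bar>shifted_gauss_moment (2 * q - 1) z - sqrt pi *
           (\<Sum>j<N. ((q - 1 / 2) gchoose j) * ((- 1) ^ j * pochhammer (1 - q) j) * z powr (2 * q - 1 - 2 * real j))\<bar>
         \<le> C * z powr (2 * q - 1 - 2 * real N)"
proof -
  define p where "p = 2 * q - 1"
  define b where "b j = (q - 1 / 2 gchoose j) * ((- 1) ^ j * pochhammer (1 - q) j)" for j
  define N' where "N' = max N (Suc (nat \<lceil>p\<rceil>))"
  have N': "N \<le> N'" "0 < N'" by (auto simp: N'_def)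
  have "real (Suc (nat \<lceil>p\<rceil>)) \<le> real N'" by (simp add: N'_def)
  hence pN': "p \<le> 2 * real N'" using real_nat_ceiling_ge[of p] by linarith
  have "p > -1" using q by (simp add: p_def)
  from shifted_gauss_moment_expansion[OF this N'(2) pN']
  obtain C where C: "\<And>z. z \<ge> 1 \<Longrightarrow> \<bar>shifted_gauss_moment p z - sqrt pi * (\<Sum>j<N'. b j * z powr (p - 2 * real j))\<bar>
     \<le> C * z powr (p - 2 * real N')"
    unfolding p_def gbinomial_double_fact b_def by blast
  have "\<bar>shifted_gauss_moment p z - sqrt pi * (\<Sum>j<N. b j * z powr (p - 2 * real j))\<bar>
     \<le> (\<bar>C\<bar> + sqrt pi * (\<Sum>j=N..<N'. \<bar>b j\<bar>)) * z powr (p - 2 * real N)" if z: "z \<ge> 1" for z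
  proof -
    define T where "T = (\<Sum>j=N..<N'. b j * z powr (p - 2 * real j))"
    have "(\<Sum>j<N'. b j * z powr (p - 2 * real j)) = (\<Sum>j<N. b j * z powr (p - 2 * real j)) + T"
      unfolding T_def using N' by (subst sum.union_disjoint[symmetric]) (auto intro: sum.cong)
    hence "shifted_gauss_moment p z - sqrt pi * (\<Sum>j<N. b j * z powr (p - 2 * real j)) =
      (shifted_gauss_moment p z - sqrt pi * (\<Sum>j<N'. b j * z powr (p - 2 * real j))) + sqrt pi * T"
      by (simp add: algebra_simps)
    also have "\<bar>\<dots>\<bar> \<le> C * z powr (p - 2 * real N') + \<bar>sqrt pi * T\<bar>"
      using C[OF z] by linarith
    also have "C * z powr (p - 2 * real N') \<le> \<bar>C\<bar> * z powr (p - 2 * real N)"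
      using z N' by (intro mult_mono powr_mono) auto
    also have "\<bar>sqrt pi * T\<bar> \<le> sqrt pi * (\<Sum>j=N..<N'. \<bar>b j\<bar> * z powr (p - 2 * real N))"
    proof -
      have "\<bar>T\<bar> \<le> (\<Sum>j=N..<N'. \<bar>b j\<bar> * z powr (p - 2 * real N))"
        unfolding T_def using z
        by (intro order.trans[OF sum_abs] sum_mono) (auto simp: abs_mult intro!: mult_left_mono powr_mono)
      thus ?thesis by (simp add: abs_mult mult_left_mono)
    qed
    finally show ?thesis by (simp add: sum_distrib_right algebra_simps)
  qed
  thus ?thesis unfolding p_def b_def by blast
qed

subsection \<open>The complementary error function and the Gamma function at half-integers\<close>

lemma has_integral_erfc:
  "((\<lambda>t. exp (- t\<^sup>2)) has_integral (sqrt pi / 2 * erfc z)) {z..}" for z :: real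
proof -
  have "integrable lborel (\<lambda>t::real. exp (- t\<^sup>2))"
    using has_bochner_integral_even_function[OF gaussian_moment_0] by (auto simp: has_bochner_integral_iff)
  hence "set_integrable lborel {z..} (\<lambda>t. exp (- t\<^sup>2))"
    unfolding set_integrable_def by (intro integrable_mult_indicator) auto
  hence "(\<lambda>t. exp (- t\<^sup>2)) integrable_on {z..}" by (rule set_borel_integral_eq_integral)
  thus ?thesis by (simp add: erfc_def has_integral_integral)
qed

lemma erfc_nonneg: "erfc z \<ge> 0"
  using has_integral_nonneg[OF has_integral_erfc[of z]] pi_gt_zero by (auto simp: zero_le_mult_iff)

lemma erfc_has_real_derivative:
  "(erfc has_real_derivative - (2 / sqrt pi * exp (- s\<^sup>2))) (at s)" for s :: real
proof -
  \<comment> \<open>A base point to the left of s turns the half-line integral into a constant minus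
    an integral over a compact interval, to which the fundamental theorem of calculus
    applies.\<close>
  define a where "a = s - 1"
  have eq: "erfc x = erfc a - 2 / sqrt pi * integral {a..x} (\<lambda>t. exp (- t\<^sup>2))" if "x \<ge> a" for x
  proof -
    have "((\<lambda>t. exp (- t\<^sup>2)) has_integral integral {a..x} (\<lambda>t. exp (- t\<^sup>2))) {a..x}"
      by (intro integrable_integral integrable_continuous_real continuous_intros)
    moreover have "{a..x} \<inter> {x..} = {x}" using that by auto
    ultimately    have "((\<lambda>t. exp (- t\<^sup>2)) has_integral
        integral {a..x} (\<lambda>t. exp (- t\<^sup>2)) + sqrt pi / 2 * erfc x) ({a..x} \<union> {x..})"
      by (intro has_integral_Un has_integral_erfc) auto
    also have "{a..x} \<union> {x..} = {a..}" using that by auto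
    finally have "integral {a..x} (\<lambda>t. exp (- t\<^sup>2)) + sqrt pi / 2 * erfc x = sqrt pi / 2 * erfc a"
      using has_integral_erfc has_integral_unique by blast
    thus ?thesis by (simp add: field_simps)
  qed
  have "((\<lambda>x. integral {a..x} (\<lambda>t. exp (- t\<^sup>2))) has_real_derivative exp (- s\<^sup>2)) (at s within {a..s+1})"
    by (intro integral_has_real_derivative continuous_intros) (auto simp: a_def)
  moreover have "at s within {a..s+1} = at s"
    by (rule at_within_Icc_at) (auto simp: a_def)
  ultimately have "((\<lambda>x. integral {a..x} (\<lambda>t. exp (- t\<^sup>2))) has_real_derivative exp (- s\<^sup>2)) (at s)"
    by simp
  from DERIV_diff[OF DERIV_const[of "erfc a"] DERIV_cmult[OF this, of "2 / sqrt pi"]]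
  have "((\<lambda>x. erfc a - 2 / sqrt pi * integral {a..x} (\<lambda>t. exp (- t\<^sup>2)))
      has_real_derivative - (2 / sqrt pi * exp (- s\<^sup>2))) (at s)"
    by (simp only: diff_0)
  moreover have "eventually (\<lambda>x. x > a) (nhds s)"
    using eventually_nhds_in_open[of "{a<..}" s] by (simp add: a_def)
  hence "eventually (\<lambda>x. erfc x = erfc a - 2 / sqrt pi * integral {a..x} (\<lambda>t. exp (- t\<^sup>2))) (nhds s)"
    by eventually_elim (intro eq, auto)
  ultimately show ?thesis by (subst DERIV_cong_ev[OF refl _ refl])
qed

lemma erfc_tendsto_0: "(erfc \<longlongrightarrow> 0) at_top"
proof (rule tendsto_sandwich)
  show "eventually (\<lambda>z. 0 \<le> erfc z) at_top" by (simp add: erfc_nonneg)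
  show "eventually (\<lambda>z. erfc z \<le> 2 / sqrt pi * exp (- z)) at_top"
    using eventually_ge_at_top[of 1]
  proof eventually_elim
    case (elim z)
    have "((\<lambda>t. exp (- t)) has_integral exp (- z)) {z..}"
      using has_integral_exp_minus_to_infinity[of 1 z] by simp
    with has_integral_erfc[of z] have "sqrt pi / 2 * erfc z \<le> exp (- z)"
    proof (rule has_integral_le)
      fix t assume "t \<in> {z..}"
      hence "1 * t \<le> t * t" using elim by (intro mult_right_mono) auto
      thus "exp (- t\<^sup>2) \<le> exp (- t)" by (simp add: power2_eq_square)
    qed
    thus ?case by (simp add: field_simps)
  qed
  show "((\<lambda>z::real. 2 / sqrt pi * exp (- z)) \<longlongrightarrow> 0) at_top" by real_asymp
qed auto

text \<open>Legendre's duplication formula at half-integers. From k to k + 1 the two factors change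
  places and one of them gains the factor (k + 1)/2, so induction suffices.\<close>

lemma Gamma_half_duplication:
  "Gamma ((real k + 1) / 2) * Gamma (real k / 2 + 1) = sqrt pi * fact k / 2 ^ k"
proof (induction k)
  case (Suc k)
  have "(real (Suc k) + 1) / 2 = real k / 2 + 1" "real (Suc k) / 2 + 1 = (real k + 1) / 2 + 1" by auto
  note eq = this
  have "Gamma ((real k + 1) / 2 + 1) = (real k + 1) / 2 * Gamma ((real k + 1) / 2)"
    by (rule Gamma_plus1) (auto elim!: nonpos_Ints_cases)
  hence "Gamma ((real (Suc k) + 1) / 2) * Gamma (real (Suc k) / 2 + 1) =
      (real k + 1) / 2 * (Gamma ((real k + 1) / 2) * Gamma (real k / 2 + 1))" unfolding eq by simp
  also have "\<dots> = sqrt pi * fact (Suc k) / 2 ^ Suc k" unfolding Suc.IH by (simp add: field_simps)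
  finally show ?case .
qed (simp add: Gamma_one_half_real)

text \<open>The series is the Mittag-Leffler function of order 1/2, equal to exp(s^2) (1 + erf s).
  The even terms sum to exp(s^2); the odd ones are compared with it through Gamma(j + 3/2) \<ge>
  (sqrt(pi)/2) j!.\<close>

lemma summable_powser_inverse_Gamma_half:
  fixes s :: real
  assumes s: "s \<ge> 0"
  shows "summable (\<lambda>k. s ^ k / Gamma (real k / 2 + 1))"
    and "(\<Sum>k. s ^ k / Gamma (real k / 2 + 1)) \<le> (1 + 2 / sqrt pi * s) * exp (s\<^sup>2)"
proof -
  have G: "Gamma (real j + 3 / 2) \<ge> sqrt pi / 2 * fact j" for j :: nat
  proof (induction j)
    case 0
    have "Gamma (1 / 2 + 1 :: real) = 1 / 2 * Gamma (1 / 2)" by (rule Gamma_plus1) auto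
    thus ?case by (simp add: Gamma_one_half_real)
  next
    case (Suc j)
    have "Gamma (real (Suc j) + 3 / 2) = Gamma (real j + 3 / 2 + 1)" by (simp add: add_ac)
    also have "\<dots> = (real j + 3 / 2) * Gamma (real j + 3 / 2)"
      by (rule Gamma_plus1) (auto elim!: nonpos_Ints_cases)
    also have "\<dots> \<ge> (real j + 1) * (sqrt pi / 2 * fact j)" by (intro mult_mono Suc.IH) auto
    finally show ?case by (simp add: algebra_simps)
  qed
  have "(\<lambda>j. (s\<^sup>2) ^ j /\<^sub>R fact j) sums exp (s\<^sup>2)" by (rule exp_converges)
  hence ev: "(\<lambda>j. s ^ (2 * j) / fact j) sums exp (s\<^sup>2)"
    by (simp add: divide_inverse mult.commute[of _ "inverse _"] flip: power_mult)
  have od_b: "s ^ (2 * j + 1) / Gamma (real j + 3 / 2) \<le> 2 / sqrt pi * s * (s ^ (2 * j) / fact j)" for j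
  proof -
    have "s ^ (2 * j + 1) / Gamma (real j + 3 / 2) \<le> s ^ (2 * j + 1) / (sqrt pi / 2 * fact j)"
      using s by (intro divide_left_mono G mult_pos_pos Gamma_real_pos) auto
    thus ?thesis by (simp add: field_simps)
  qed
  have b: "(\<lambda>j. 2 / sqrt pi * s * (s ^ (2 * j) / fact j)) sums (2 / sqrt pi * s * exp (s\<^sup>2))"
    by (intro sums_mult ev)
  have od: "summable (\<lambda>j. s ^ (2 * j + 1) / Gamma (real j + 3 / 2))"
  proof (rule summable_comparison_test'[OF sums_summable[OF b], of 0])
    fix j :: nat
    have "Gamma (real j + 3 / 2) > 0" by (intro Gamma_real_pos) auto
    thus "norm (s ^ (2 * j + 1) / Gamma (real j + 3 / 2)) \<le> 2 / sqrt pi * s * (s ^ (2 * j) / fact j)"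
      using od_b[of j] s by simp
  qed
  have "(\<Sum>j. s ^ (2 * j + 1) / Gamma (real j + 3 / 2)) \<le> 2 / sqrt pi * s * exp (s\<^sup>2)"
    using suminf_le[OF od_b od sums_summable[OF b]] b by (simp add: sums_iff)
  moreover have "(\<lambda>k. if even k then s ^ (2 * (k div 2)) / fact (k div 2)
       else s ^ (2 * ((k - 1) div 2) + 1) / Gamma (real ((k - 1) div 2) + 3 / 2)) =
     (\<lambda>k. s ^ k / Gamma (real k / 2 + 1))"
  proof
    fix k :: nat
    show "(if even k then s ^ (2 * (k div 2)) / fact (k div 2)
       else s ^ (2 * ((k - 1) div 2) + 1) / Gamma (real ((k - 1) div 2) + 3 / 2)) =
      s ^ k / Gamma (real k / 2 + 1)"
    proof (cases "even k")
      case True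
      then obtain j where "k = 2 * j" by auto
      thus ?thesis using Gamma_fact[of j, where 'a = real] by (simp add: add.commute)
    next
      case False
      then obtain j where "k = 2 * j + 1" by (elim oddE)
      thus ?thesis by (simp add: add_divide_distrib add.commute)
    qed
  qed
  ultimately have *: "(\<lambda>k. s ^ k / Gamma (real k / 2 + 1)) sums
      ((\<Sum>j. s ^ (2 * j + 1) / Gamma (real j + 3 / 2)) + exp (s\<^sup>2))"
    and le: "(\<Sum>j. s ^ (2 * j + 1) / Gamma (real j + 3 / 2)) \<le> 2 / sqrt pi * s * exp (s\<^sup>2)"
    using sums_if[OF summable_sums[OF od] ev] by simp_all
  show "summable (\<lambda>k. s ^ k / Gamma (real k / 2 + 1))" using * by (simp add: sums_iff)
  show "(\<Sum>k. s ^ k / Gamma (real k / 2 + 1)) \<le> (1 + 2 / sqrt pi * s) * exp (s\<^sup>2)"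
    using * le by (simp add: sums_iff algebra_simps)
qed

subsection \<open>The incomplete beta function\<close>

lemma Beta_real_pos: "a > 0 \<Longrightarrow> b > 0 \<Longrightarrow> Beta a b > 0" for a b :: real
  by (auto simp: Beta_def intro!: divide_pos_pos mult_pos_pos Gamma_real_pos)

lemma Beta_one_left: "Beta 1 b = 1 / b" if b: "b > 0" for b :: real
proof -
  have "Gamma (b + 1) = b * Gamma b" using b by (auto intro!: Gamma_plus1 elim!: nonpos_Ints_cases)
  moreover have "Gamma b \<noteq> 0" using Gamma_real_pos[OF b] by linarith
  ultimately show ?thesis using b by (simp add: Beta_def add.commute)
qed

lemma integrable_inc_beta:
  fixes a b c d :: real
  assumes "a > 0" "b > 0" "0 \<le> c" "d \<le> 1"
  shows "(\<lambda>t. t powr (a - 1) * (1 - t) powr (b - 1)) integrable_on {c..d}"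
  using integrable_Beta'[OF assms(1,2)] by (rule integrable_on_subinterval) (use assms in auto)

lemma inc_beta_nonneg:
  assumes "a > 0" "b > 0" "0 \<le> y" "y \<le> 1"
  shows "inc_beta y a b \<ge> 0"
  unfolding inc_beta_def using assms Beta_real_pos[of a b]
  by (intro mult_nonneg_nonneg integral_nonneg integrable_inc_beta) auto

text \<open>Integrate the derivative of t^a (1-t)^b over [0, y]; it is a combination of the
  integrands for a and a + 1, and Beta(a+1, b) is a/(a+b) times Beta(a, b).\<close>

lemma inc_beta_diff:
  assumes a: "a > 0" and b: "b > 0" and y: "0 < y" "y < 1"
  shows "inc_beta y a b - inc_beta y (a + 1) b =
           y powr a * (1 - y) powr b * Gamma (a + b) / (Gamma (a + 1) * Gamma b)"
proof -
  define f where "f a t = t powr (a - 1) * (1 - t) powr (b - 1)" for a t :: real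
  have int: "(f a' has_integral integral {0..y} (f a')) {0..y}" if "a' > 0" for a'
    unfolding f_def using y that b by (intro integrable_integral integrable_inc_beta) auto
  have I1: "((\<lambda>t. a * f a t - (a + b) * f (a + 1) t) has_integral
          (y powr a * (1 - y) powr b - 0 powr a * (1 - 0) powr b)) {0..y}"
  \<comment> \<open>Differentiability is required only inside the interval, since t^a need not be
    differentiable at 0 when a < 1.\<close>
  proof (rule fundamental_theorem_of_calculus_interior)
    show "continuous_on {0..y} (\<lambda>t. t powr a * (1 - t) powr b)"
      using a b y by (intro continuous_intros continuous_on_powr') auto
    fix t assume t: "t \<in> {0<..<y}"
    have "((\<lambda>t. t powr a * (1 - t) powr b) has_real_derivative
        a * t powr (a - 1) * (1 - t) powr b - t powr a * (b * (1 - t) powr (b - 1))) (at t)"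
      using t y by (auto intro!: derivative_eq_intros)
    also have "a * t powr (a - 1) * (1 - t) powr b - t powr a * (b * (1 - t) powr (b - 1)) =
       a * f a t - (a + b) * f (a + 1) t"
    proof -
      have e: "t powr a = t * t powr (a - 1)" "t powr (a + 1 - 1) = t * t powr (a - 1)"
          "(1 - t) powr b = (1 - t) * (1 - t) powr (b - 1)"
        using t y by (simp_all add: powr_diff)
      show ?thesis unfolding f_def e by (simp add: algebra_simps)
    qed
    finally show "((\<lambda>t. t powr a * (1 - t) powr b) has_vector_derivative
       a * f a t - (a + b) * f (a + 1) t) (at t)"
      unfolding has_real_derivative_iff_has_vector_derivative .
  qed (use y in auto)
  have I2: "((\<lambda>t. a * f a t - (a + b) * f (a + 1) t) has_integral
      (a * integral {0..y} (f a) - (a + b) * integral {0..y} (f (a + 1)))) {0..y}"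
    using a by (intro has_integral_diff has_integral_mult_right int) auto
  have eq: "a * integral {0..y} (f a) - (a + b) * integral {0..y} (f (a + 1)) = y powr a * (1 - y) powr b"
    using has_integral_unique[OF I2 I1] a by simp
  have G: "Gamma (a + 1) = a * Gamma a" "Gamma (a + b + 1) = (a + b) * Gamma (a + b)"
    using a b by (auto intro!: Gamma_plus1 elim!: nonpos_Ints_cases)
  have "Gamma a > 0" "Gamma b > 0" "Gamma (a + b) > 0" using a b by (auto intro!: Gamma_real_pos)
  hence nz: "Gamma a \<noteq> 0" "Gamma b \<noteq> 0" "Gamma (a + b) \<noteq> 0" by linarith+
  have B: "Beta (a + 1) b = a / (a + b) * Beta a b"
    using nz a b G(1) G(2)[unfolded add.assoc add.commute[of b 1]]
    by (simp add: Beta_def add.assoc)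
  have Bnz: "Beta a b \<noteq> 0" using Beta_real_pos[OF a b] by linarith
  have "inc_beta y a b - inc_beta y (a + 1) b =
    (a * integral {0..y} (f a) - (a + b) * integral {0..y} (f (a + 1))) / (a * Beta a b)"
    unfolding inc_beta_def B f_def[symmetric] using a b Bnz by (simp add: field_simps)
  also have "\<dots> = y powr a * (1 - y) powr b / (a * Beta a b)" by (simp only: eq)
  also have "\<dots> = y powr a * (1 - y) powr b * Gamma (a + b) / (Gamma (a + 1) * Gamma b)"
    using a nz by (simp add: Beta_def G)
  finally show ?thesis .
qed

text \<open>The limiting case a = 0 of the recurrence, with the value 1 in place of I_y(0,
  b).\<close>

lemma inc_beta_one:
  assumes b: "b > 0" and y: "0 < y" "y < 1"
  shows "1 - inc_beta y 1 b = (1 - y) powr b"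
proof -
  have base: "((\<lambda>t. (1 - t) powr (b - 1)) has_integral (- ((1 - y) powr b / b) - (- ((1 - 0) powr b / b)))) {0..y}"
  proof (rule fundamental_theorem_of_calculus)
    fix t assume t: "t \<in> {0..y}"
    have "((\<lambda>t. - ((1 - t) powr b / b)) has_real_derivative (1 - t) powr (b - 1)) (at t)"
      using t y b by (auto intro!: derivative_eq_intros)
    thus "((\<lambda>t. - ((1 - t) powr b / b)) has_vector_derivative (1 - t) powr (b - 1)) (at t within {0..y})"
      unfolding has_real_derivative_iff_has_vector_derivative by (rule has_vector_derivative_at_within)
  qed (use y in auto)
  \<comment> \<open>As \<open>0 powr 0 = 0\<close>, the factor \<open>t powr (1 - 1)\<close> is 1
    except at t = 0, and this one point is discarded.\<close>
  have "((\<lambda>t. t powr (1 - 1) * (1 - t) powr (b - 1)) has_integral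
      (- ((1 - y) powr b / b) - (- ((1 - 0) powr b / b)))) {0..y}"
    by (rule has_integral_spike_finite[OF _ _ base, of "{0}"]) auto
  also have "- ((1 - y) powr b / b) - (- ((1 - 0) powr b / b)) = (1 - (1 - y) powr b) / b"
    by (simp add: diff_divide_distrib)
  finally have "integral {0..y} (\<lambda>t. t powr (1 - 1) * (1 - t) powr (b - 1)) = (1 - (1 - y) powr b) / b"
    by (rule integral_unique)
  thus ?thesis using b by (simp add: inc_beta_def Beta_one_left)
qed

lemma inc_beta_le_1:
  assumes "a > 0" "b > 0" "0 \<le> y" "y \<le> 1"
  shows "inc_beta y a b \<le> 1"
proof -
  have "integral {0..y} (\<lambda>t. t powr (a - 1) * (1 - t) powr (b - 1)) \<le>
        integral {0..1} (\<lambda>t. t powr (a - 1) * (1 - t) powr (b - 1))"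
    using assms by (intro integral_subset_le integrable_inc_beta) auto
  also have "\<dots> = Beta a b" using has_integral_Beta_real[OF assms(1,2)] by (rule integral_unique)
  finally show ?thesis using Beta_real_pos[OF assms(1,2)] by (simp add: inc_beta_def field_simps)
qed

text \<open>On [0, y] the power t^(a-1) is at most y^(a-1), and on [r, 1] it is at least r^(a-1);
  the remaining integrals are those for a = 1. The resulting geometric decay in a forces the
  distribution function to vanish as \<delta> grows.\<close>

lemma inc_beta_geometric_bound:
  assumes a: "a \<ge> 1" and b: "b > 0" and y: "0 < y" "y < r" "r < 1"
  shows "inc_beta y a b \<le> (y / r) powr (a - 1) / (1 - r) powr b"
proof -
  let ?f = "\<lambda>a t::real. t powr (a - 1) * (1 - t) powr (b - 1)"
  have one: "integral {0..x} (?f 1) = (1 - (1 - x) powr b) / b" if "0 < x" "x < 1" for x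
    using inc_beta_one[OF b that] b by (simp add: inc_beta_def Beta_one_left field_simps)
  have Beta1: "integral {0..1} (?f 1) = 1 / b"
    using integral_unique[OF has_integral_Beta_real[of 1 b]] b by (simp add: Beta_one_left)
  have num: "integral {0..y} (?f a) \<le> y powr (a - 1) * (1 / b)"
  proof -
    have "integral {0..y} (?f a) \<le> integral {0..y} (\<lambda>t. y powr (a - 1) * ?f 1 t)"
    proof (rule integral_le)
      fix t assume t: "t \<in> {0..y}"
      show "?f a t \<le> y powr (a - 1) * ?f 1 t"
        using t a y by (cases "t = 0") (auto intro!: mult_right_mono powr_mono2)
    next
      show "(\<lambda>t. y powr (a - 1) * ?f 1 t) integrable_on {0..y}"
        using y b by (intro integrable_on_mult_right integrable_inc_beta) auto
    qed (use a b y in \<open>intro integrable_inc_beta, auto\<close>)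
    also have "\<dots> = y powr (a - 1) * integral {0..y} (?f 1)" by simp
    also have "integral {0..y} (?f 1) \<le> integral {0..1} (?f 1)"
      using y b by (intro integral_subset_le integrable_inc_beta) auto
    finally show ?thesis unfolding Beta1 using y by (simp add: mult_left_mono)
  qed
  have den: "r powr (a - 1) * ((1 - r) powr b / b) \<le> Beta a b"
  proof -
    have "integral {r..1} (?f 1) = integral {0..1} (?f 1) - integral {0..r} (?f 1)"
      using Henstock_Kurzweil_Integration.integral_combine[of 0 r 1 "?f 1"] y b
        integrable_inc_beta[of 1 b 0 1] by simp
    also have "\<dots> = (1 - r) powr b / b"
      unfolding Beta1 using one[of r] y b by (simp add: field_simps)
    finally have "r powr (a - 1) * ((1 - r) powr b / b) = integral {r..1} (\<lambda>t. r powr (a - 1) * ?f 1 t)"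
      by simp
    also have "\<dots> \<le> integral {r..1} (?f a)"
    proof (rule integral_le)
      fix t assume t: "t \<in> {r..1}"
      show "r powr (a - 1) * ?f 1 t \<le> ?f a t"
        using t a y by (auto intro!: mult_right_mono powr_mono2)
    next
      show "(\<lambda>t. r powr (a - 1) * ?f 1 t) integrable_on {r..1}"
        using y b by (intro integrable_on_mult_right integrable_inc_beta) auto
    qed (use a b y in \<open>intro integrable_inc_beta, auto\<close>)
    also have "\<dots> \<le> integral {0..1} (?f a)"
      using a y b by (intro integral_subset_le integrable_inc_beta) auto
    also have "\<dots> = Beta a b"
      using a b by (intro integral_unique has_integral_Beta_real) auto
    finally show ?thesis .
  qed
  have dpos: "r powr (a - 1) * ((1 - r) powr b / b) > 0" using y b by simp
  have "inc_beta y a b = integral {0..y} (?f a) / Beta a b" by (simp add: inc_beta_def)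
  also have "\<dots> \<le> (y powr (a - 1) * (1 / b)) / (r powr (a - 1) * ((1 - r) powr b / b))"
    using y b by (intro frac_le num den dpos) auto
  also have "\<dots> = (y / r) powr (a - 1) / (1 - r) powr b"
    using y b by (simp add: powr_divide)
  finally show ?thesis .
qed

subsection \<open>The noncentral t-distribution for fixed y\<close>

text \<open>The distribution as a function of \<open>s = \<delta>/\<surd>2\<close>: the even-indexed terms form \<open>P\<^sub>n\<close>, the odd-indexed
  ones \<open>Q\<^sub>n\<close>.\<close>

definition nct_G :: "real \<Rightarrow> real \<Rightarrow> real \<Rightarrow> real" where
  "nct_G y b s = 1 / 2 * erfc s + 1 / 2 * exp (- s\<^sup>2) *
     (\<Sum>k. inc_beta y ((real k + 1) / 2) b / Gamma (real k / 2 + 1) * s ^ k)"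

lemma summable_inc_beta_powser:
  fixes s :: real
  assumes b: "b > 0" and y: "0 < y" "y < 1"
  shows "summable (\<lambda>k. inc_beta y ((real k + 1) / 2) b / Gamma (real k / 2 + 1) * s ^ k)"
proof (rule summable_comparison_test'[OF summable_powser_inverse_Gamma_half(1)[of "\<bar>s\<bar>"], of 0])
  fix k :: nat
  have "\<bar>inc_beta y ((real k + 1) / 2) b\<bar> \<le> 1"
    using inc_beta_nonneg[of "(real k + 1) / 2" b y] inc_beta_le_1[of "(real k + 1) / 2" b y] b y by auto
  hence "\<bar>inc_beta y ((real k + 1) / 2) b\<bar> * (\<bar>s\<bar> ^ k / Gamma (real k / 2 + 1)) \<le>
      1 * (\<bar>s\<bar> ^ k / Gamma (real k / 2 + 1))"
    by (intro mult_right_mono divide_nonneg_nonneg less_imp_le[OF Gamma_real_pos]) auto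
  moreover have "Gamma (real k / 2 + 1) > 0" by (intro Gamma_real_pos) auto
  ultimately show "norm (inc_beta y ((real k + 1) / 2) b / Gamma (real k / 2 + 1) * s ^ k) \<le>
      \<bar>s\<bar> ^ k / Gamma (real k / 2 + 1)"
    by (simp add: abs_mult power_abs)
qed auto

lemma nct_F_eq_nct_G:
  assumes n: "n > 0" and \<delta>: "\<delta> > 0" and y: "0 < nct_y n x" "nct_y n x < 1"
  shows "nct_F n x \<delta> = nct_G (nct_y n x) (n / 2) (\<delta> / sqrt 2)"
proof -
  define s where "s = \<delta> / sqrt 2"
  have s: "s > 0" "s\<^sup>2 = \<delta>\<^sup>2 / 2" using \<delta> by (auto simp: s_def power_divide)
  define W where "W k = inc_beta (nct_y n x) ((real k + 1) / 2) (n / 2) / Gamma (real k / 2 + 1) * s ^ k" for k :: nat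
  have W: "summable W" unfolding W_def using n y by (intro summable_inc_beta_powser) auto
  have W0: "W k \<ge> 0" for k
  proof -
    have "inc_beta (nct_y n x) ((real k + 1) / 2) (n / 2) \<ge> 0" using n y by (intro inc_beta_nonneg) auto
    moreover have "Gamma (real k / 2 + 1) > 0" by (intro Gamma_real_pos) auto
    ultimately show ?thesis using s by (simp add: W_def)
  qed
  \<comment> \<open>The terms are nonnegative because s > 0, so both subseries converge and may be
    summed separately.\<close>
  have ev: "summable (\<lambda>j. W (2 * j))"
    using summable_reindex[OF W, of "\<lambda>j. 2 * j"] W0 by (auto simp: inj_def o_def)
  have od: "summable (\<lambda>j. W (2 * j + 1))"
    using summable_reindex[OF W, of "\<lambda>j. 2 * j + 1"] W0 by (auto simp: inj_def o_def)
  have "(\<lambda>k. if even k then W (2 * (k div 2)) else W (2 * ((k - 1) div 2) + 1)) = W"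
    by (auto simp: fun_eq_iff)
  hence "W sums ((\<Sum>j. W (2 * j + 1)) + (\<Sum>j. W (2 * j)))"
    using sums_if[OF summable_sums[OF od] summable_sums[OF ev]] by simp
  hence tot: "suminf W = (\<Sum>j. W (2 * j + 1)) + (\<Sum>j. W (2 * j))" by (simp add: sums_iff)
  have "W (2 * j) = (\<delta>\<^sup>2 / 2) ^ j / fact j * inc_beta (nct_y n x) (real j + 1 / 2) (n / 2)" for j
  proof -
    have e: "Gamma (real (2 * j) / 2 + 1) = fact j" "(real (2 * j) + 1) / 2 = real j + 1 / 2"
      using Gamma_fact[of j, where 'a = real] by (simp_all add: add.commute add_divide_distrib)
    show ?thesis unfolding W_def e power_mult s(2) by (simp add: mult_ac)
  qed
  moreover have "W (2 * j + 1) = \<delta> / sqrt 2 * ((\<delta>\<^sup>2 / 2) ^ j / Gamma (real j + 3 / 2)) *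
          inc_beta (nct_y n x) (real j + 1) (n / 2)" for j
  proof -
    have e: "real (2 * j + 1) / 2 + 1 = real j + 3 / 2" "(real (2 * j + 1) + 1) / 2 = real j + 1"
      by (simp_all add: field_simps)
    show ?thesis unfolding W_def e power_add power_mult s(2) by (simp add: s_def mult_ac)
  qed
  ultimately have "nct_P n x \<delta> + nct_Q n x \<delta> = 1 / 2 * exp (- s\<^sup>2) * suminf W"
    unfolding nct_P_def nct_Q_def tot s(2) by (simp add: algebra_simps)
  thus ?thesis unfolding nct_F_def nct_G_def s_def[symmetric] W_def by simp
qed

text \<open>With W the power series, the derivative is -exp(-s^2)/2 times 2/sqrt(pi) + 2 s W - W'.
  In the coefficient of s^k only two neighbouring incomplete beta values meet; their difference is a
  Gamma quotient, which the duplication formula reduces to the stated one.\<close>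

lemma nct_G_has_real_derivative:
  fixes s :: real
  assumes b: "b > 0" and y: "0 < y" "y < 1"
  shows "\<exists>S. (\<lambda>k. (2 * (s * sqrt y)) ^ k / fact k * Gamma (real k / 2 + b)) sums S \<and>
    (nct_G y b has_real_derivative - (exp (- s\<^sup>2) * (1 - y) powr b / (Gamma b * sqrt pi) * S)) (at s)"
proof -
  define I where "I k = inc_beta y ((real k + 1) / 2) b" for k :: nat
  define w where "w k = I k / Gamma (real k / 2 + 1)" for k :: nat
  define W where "W s = (\<Sum>k. w k * s ^ k)" for s :: real
  have w: "summable (\<lambda>k. w k * s ^ k)" for s :: real
    unfolding w_def I_def using b y by (rule summable_inc_beta_powser)
  define W' where "W' = (\<Sum>k. diffs w k * s ^ k)"
  have dW: "(W has_real_derivative W') (at s)"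
    unfolding W_def W'_def by (rule termdiffs_strong_converges_everywhere[OF w])
  have dws: "(\<lambda>k. diffs w k * s ^ k) sums W'"
    unfolding W'_def using termdiff_converges_all[OF w] by (rule summable_sums)
  \<comment> \<open>\<open>v\<close> holds the coefficients of 2 s W, and \<open>u\<close> below
    those of the constant contributed by erfc.\<close>
  define v where "v k = (case k of 0 \<Rightarrow> 0 | Suc j \<Rightarrow> 2 * w j)" for k :: nat
  have "(\<lambda>k. 2 * s * (w k * s ^ k)) sums (2 * s * W s)"
    unfolding W_def by (intro sums_mult summable_sums w)
  hence "(\<lambda>k. v (Suc k) * s ^ Suc k) sums (2 * s * W s)" by (simp add: v_def mult_ac)
  from sums_Suc[OF this] have vs: "(\<lambda>k. v k * s ^ k) sums (2 * s * W s)" by (simp add: v_def)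
  define u where "u k = (if k = 0 then 2 / sqrt pi else 0)" for k :: nat
  have us: "(\<lambda>k. u k * s ^ k) sums (2 / sqrt pi)"
  proof -
    have "(\<lambda>k. u k * s ^ k) = (\<lambda>k. if k = 0 then 2 / sqrt pi else 0)" by (auto simp: u_def)
    thus ?thesis using sums_single[of 0 "\<lambda>_. 2 / sqrt pi"] by simp
  qed
  define K where "K = 2 * ((1 - y) powr b / (Gamma b * sqrt pi))"
  define T where "T = 2 / sqrt pi + 2 * s * W s - W'"
  have Gb: "Gamma b > 0" using b by (rule Gamma_real_pos)
  have Kpos: "K > 0" using y Gb by (simp add: K_def)
  have coeff: "u k + v k - diffs w k = K * ((2 * sqrt y) ^ k / fact k * Gamma (real k / 2 + b))" for k
  proof -
    have Gk: "Gamma (real k / 2 + 1) > 0" "Gamma ((real k + 1) / 2) > 0" by (auto intro!: Gamma_real_pos)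
    define D where "D = sqrt y ^ k * (1 - y) powr b * Gamma (real k / 2 + b) / (Gamma (real k / 2 + 1) * Gamma b)"
    have dw: "diffs w k = 2 / Gamma ((real k + 1) / 2) * I (Suc k)"
    proof -
      have "Gamma ((real k + 1) / 2 + 1) = (real k + 1) / 2 * Gamma ((real k + 1) / 2)"
        by (rule Gamma_plus1) (auto elim!: nonpos_Ints_cases)
      moreover have "real (Suc k) / 2 + 1 = (real k + 1) / 2 + 1" by simp
      ultimately have "w (Suc k) = I (Suc k) / ((real k + 1) / 2 * Gamma ((real k + 1) / 2))"
        unfolding w_def by metis
      hence "diffs w k = (real k + 1) * (I (Suc k) / ((real k + 1) / 2 * Gamma ((real k + 1) / 2)))"
        by (simp add: diffs_def add.commute)
      also have "\<dots> = 2 / Gamma ((real k + 1) / 2) * I (Suc k)"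
      proof -
        have "m * (i / (m / 2 * g)) = 2 / g * i" if "m > 0" for m i g :: real
          using that by (simp add: field_simps)
        thus ?thesis by simp
      qed
      finally show ?thesis .
    qed
    have "u k + v k - diffs w k = 2 / Gamma ((real k + 1) / 2) * D"
    proof (cases k)
      \<comment> \<open>Here the constant from erfc supplies the 1 that stands for I_y(0,
        b).\<close>
      case 0
      have "D = (1 - y) powr b" using Gb 0 by (simp add: D_def)
      also have "\<dots> = 1 - I 1" using inc_beta_one[OF b y] by (simp add: I_def)
      finally have D: "D = 1 - I 1" .
      show ?thesis unfolding dw D using 0
        by (simp add: u_def v_def Gamma_one_half_real right_diff_distrib diff_divide_distrib)
    next
      case (Suc j)
      have a: "real k / 2 > 0" using Suc by simp
      have "inc_beta y (real k / 2) b - inc_beta y (real k / 2 + 1) b =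
         y powr (real k / 2) * (1 - y) powr b * Gamma (real k / 2 + b) / (Gamma (real k / 2 + 1) * Gamma b)"
        by (rule inc_beta_diff[OF a b y])
      also have "y powr (real k / 2) = sqrt y ^ k"
        using y powr_powr[of y "1/2" "real k"] by (simp add: powr_half_sqrt powr_realpow)
      also have "inc_beta y (real k / 2) b = I j" by (simp add: I_def Suc add.commute)
      also have "inc_beta y (real k / 2 + 1) b = I (Suc k)" by (simp add: I_def add_divide_distrib add.commute)
      finally have D: "D = I j - I (Suc k)" unfolding D_def by simp
      have "v k = 2 / Gamma ((real k + 1) / 2) * I j"
        by (simp add: v_def w_def Suc add_divide_distrib add.commute)
      thus ?thesis unfolding dw D using Suc by (simp add: u_def algebra_simps diff_divide_distrib)
    qed
    also have "\<dots> = 2 * (sqrt y ^ k * (1 - y) powr b * Gamma (real k / 2 + b)) /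
        (Gamma b * (Gamma ((real k + 1) / 2) * Gamma (real k / 2 + 1)))"
      unfolding D_def by (simp add: mult_ac)
    also have "\<dots> = K * ((2 * sqrt y) ^ k / fact k * Gamma (real k / 2 + b))"
      unfolding Gamma_half_duplication K_def by (simp add: power_mult_distrib mult_ac)
    finally show ?thesis .
  qed
  have "(\<lambda>k. u k * s ^ k + v k * s ^ k - diffs w k * s ^ k) sums T"
    unfolding T_def by (intro sums_diff sums_add us vs dws)
  also have "(\<lambda>k. u k * s ^ k + v k * s ^ k - diffs w k * s ^ k) =
      (\<lambda>k. K * ((2 * (s * sqrt y)) ^ k / fact k * Gamma (real k / 2 + b)))"
  proof
    fix k
    have "u k * s ^ k + v k * s ^ k - diffs w k * s ^ k = (u k + v k - diffs w k) * s ^ k"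
      by (simp add: algebra_simps)
    thus "u k * s ^ k + v k * s ^ k - diffs w k * s ^ k =
        K * ((2 * (s * sqrt y)) ^ k / fact k * Gamma (real k / 2 + b))"
      unfolding coeff by (simp add: power_mult_distrib mult_ac)
  qed
  finally have "(\<lambda>k. K * ((2 * (s * sqrt y)) ^ k / fact k * Gamma (real k / 2 + b))) sums T" .
  from sums_mult[OF this, of "1 / K"]
  have S: "(\<lambda>k. (2 * (s * sqrt y)) ^ k / fact k * Gamma (real k / 2 + b)) sums (T / K)"
    using Kpos by simp
  have G: "nct_G y b = (\<lambda>s. 1 / 2 * erfc s + 1 / 2 * exp (- s\<^sup>2) * W s)"
    by (simp add: nct_G_def W_def w_def I_def fun_eq_iff)
  have "((\<lambda>s. 1 / 2 * erfc s + 1 / 2 * exp (- s\<^sup>2) * W s) has_real_derivative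
      1 / 2 * (- (2 / sqrt pi * exp (- s\<^sup>2))) + (1 / 2 * (exp (- s\<^sup>2) * (- (2 * s))) * W s + 1 / 2 * exp (- s\<^sup>2) * W')) (at s)"
    by (rule derivative_eq_intros erfc_has_real_derivative dW refl | simp)+
  also have "1 / 2 * (- (2 / sqrt pi * exp (- s\<^sup>2))) +
      (1 / 2 * (exp (- s\<^sup>2) * (- (2 * s))) * W s + 1 / 2 * exp (- s\<^sup>2) * W') = - (1 / 2 * exp (- s\<^sup>2) * T)"
    unfolding T_def by (simp add: algebra_simps)
  also have "\<dots> = - (exp (- s\<^sup>2) * (1 - y) powr b / (Gamma b * sqrt pi) * (T / K))"
  proof -
    have "exp (- s\<^sup>2) * (1 - y) powr b / (Gamma b * sqrt pi) * (T / K) = exp (- s\<^sup>2) * (K / 2) * (T / K)"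
      by (simp add: K_def)
    also have "\<dots> = 1 / 2 * exp (- s\<^sup>2) * T" using Kpos by simp
    finally show ?thesis by simp
  qed
  finally show ?thesis using S unfolding G by blast
qed

text \<open>The incomplete beta values decay like \<rho>^k with \<rho> < 1, so the series grows no
  faster than (1 + const s) exp(\<rho>^2 s^2), which exp(-s^2) outweighs.\<close>

lemma nct_G_tendsto_0:
  assumes b: "b > 0" and y: "0 < y" "y < 1"
  shows "(nct_G y b \<longlongrightarrow> 0) at_top"
proof -
  define r where "r = (1 + y) / 2"
  define \<rho> where "\<rho> = sqrt (y / r)"
  define C where "C = max 1 (1 / (\<rho> * (1 - r) powr b))"
  have r: "y < r" "r < 1" "0 < r" using y by (auto simp: r_def)
  have \<rho>: "0 < \<rho>" "\<rho> < 1" using r y by (auto simp: \<rho>_def)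
  have bound: "inc_beta y ((real k + 1) / 2) b \<le> C * \<rho> ^ k" for k :: nat
  proof (cases k)
    case 0
    have "inc_beta y ((real k + 1) / 2) b \<le> 1" using b y by (intro inc_beta_le_1) auto
    also have "\<dots> \<le> C" by (simp add: C_def)
    finally show ?thesis using 0 by simp
  next
    case (Suc j)
    have "inc_beta y ((real k + 1) / 2) b \<le> (y / r) powr ((real k + 1) / 2 - 1) / (1 - r) powr b"
      using Suc b y r by (intro inc_beta_geometric_bound) auto
    also have "(real k + 1) / 2 - 1 = real j / 2" using Suc by (simp add: field_simps)
    also have "(y / r) powr (real j / 2) = \<rho> ^ j"
      using y r powr_powr[of "y / r" "1/2" "real j"] \<rho> by (simp add: \<rho>_def powr_half_sqrt powr_realpow)
    also have "\<rho> ^ j / (1 - r) powr b = 1 / (\<rho> * (1 - r) powr b) * \<rho> ^ k"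
      using \<rho> Suc by simp
    also have "\<dots> \<le> C * \<rho> ^ k" using \<rho> by (intro mult_right_mono) (auto simp: C_def)
    finally show ?thesis .
  qed
  have W: "(\<Sum>k. inc_beta y ((real k + 1) / 2) b / Gamma (real k / 2 + 1) * s ^ k) \<in>
     {0..C * ((1 + 2 / sqrt pi * s) * exp (\<rho>\<^sup>2 * s\<^sup>2))}" if s: "s \<ge> 0" for s
  proof -
    have Gk: "Gamma (real k / 2 + 1) > 0" for k by (intro Gamma_real_pos) auto
    have "inc_beta y ((real k + 1) / 2) b \<ge> 0" for k :: nat using b y by (intro inc_beta_nonneg) auto
    hence nonneg: "0 \<le> (\<Sum>k. inc_beta y ((real k + 1) / 2) b / Gamma (real k / 2 + 1) * s ^ k)"
      using s by (intro suminf_nonneg summable_inc_beta_powser b y mult_nonneg_nonneg divide_nonneg_nonneg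
          less_imp_le[OF Gk]) auto
    have "(\<rho> * s) \<ge> 0" using \<rho> s by simp
    note E = summable_powser_inverse_Gamma_half[OF this]
    have "(\<Sum>k. inc_beta y ((real k + 1) / 2) b / Gamma (real k / 2 + 1) * s ^ k) \<le>
        (\<Sum>k. C * ((\<rho> * s) ^ k / Gamma (real k / 2 + 1)))"
    proof (intro suminf_le summable_inc_beta_powser b y summable_mult E(1))
      fix k :: nat
      have "inc_beta y ((real k + 1) / 2) b / Gamma (real k / 2 + 1) * s ^ k \<le>
         C * \<rho> ^ k / Gamma (real k / 2 + 1) * s ^ k"
        using s by (intro mult_right_mono divide_right_mono bound less_imp_le[OF Gk]) auto
      thus "inc_beta y ((real k + 1) / 2) b / Gamma (real k / 2 + 1) * s ^ k \<le>
         C * ((\<rho> * s) ^ k / Gamma (real k / 2 + 1))"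
        by (simp add: power_mult_distrib mult_ac)
    qed
    also have "\<dots> = C * (\<Sum>k. (\<rho> * s) ^ k / Gamma (real k / 2 + 1))" by (rule suminf_mult[OF E(1)])
    also have "\<dots> \<le> C * ((1 + 2 / sqrt pi * (\<rho> * s)) * exp ((\<rho> * s)\<^sup>2))"
      by (intro mult_left_mono E(2)) (auto simp: C_def)
    also have "\<dots> \<le> C * ((1 + 2 / sqrt pi * s) * exp (\<rho>\<^sup>2 * s\<^sup>2))"
    proof -
      have "\<rho> * s \<le> 1 * s" using \<rho> s by (intro mult_right_mono) auto
      hence "2 / sqrt pi * (\<rho> * s) \<le> 2 / sqrt pi * s" by (intro mult_left_mono) auto
      thus ?thesis by (intro mult_left_mono) (auto simp: C_def power_mult_distrib)
    qed
    finally show ?thesis using nonneg by simp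
  qed
  have "((\<lambda>s. 1 / 2 * exp (- s\<^sup>2) *
     (\<Sum>k. inc_beta y ((real k + 1) / 2) b / Gamma (real k / 2 + 1) * s ^ k)) \<longlongrightarrow> 0) at_top"
  proof (rule tendsto_sandwich)
    show "\<forall>\<^sub>F s in at_top. 0 \<le> 1 / 2 * exp (- s\<^sup>2) *
       (\<Sum>k. inc_beta y ((real k + 1) / 2) b / Gamma (real k / 2 + 1) * s ^ k)"
      using eventually_ge_at_top[of 0] by eventually_elim (use W in auto)
    show "\<forall>\<^sub>F s in at_top. 1 / 2 * exp (- s\<^sup>2) *
       (\<Sum>k. inc_beta y ((real k + 1) / 2) b / Gamma (real k / 2 + 1) * s ^ k) \<le>
       1 / 2 * exp (- s\<^sup>2) * (C * ((1 + 2 / sqrt pi * s) * exp (\<rho>\<^sup>2 * s\<^sup>2)))"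
      using eventually_ge_at_top[of 0] by eventually_elim (use W in \<open>intro mult_left_mono, auto\<close>)
    have "\<rho>\<^sup>2 < 1" using \<rho> by (simp add: abs_square_less_1)
    then obtain d where d: "d > 0" "\<rho>\<^sup>2 = 1 - d" by (metis add_diff_cancel_left' diff_add_cancel diff_gt_0_iff_gt)
    have "((\<lambda>s. 1 / 2 * (C * ((1 + 2 / sqrt pi * s) * exp (- d * s\<^sup>2)))) \<longlongrightarrow> 0) at_top"
      using d by real_asymp
    also have "(\<lambda>s. 1 / 2 * (C * ((1 + 2 / sqrt pi * s) * exp (- d * s\<^sup>2)))) =
       (\<lambda>s. 1 / 2 * exp (- s\<^sup>2) * (C * ((1 + 2 / sqrt pi * s) * exp (\<rho>\<^sup>2 * s\<^sup>2))))"
    proof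
      fix s :: real
      have "exp (- d * s\<^sup>2) = exp (- s\<^sup>2) * exp (\<rho>\<^sup>2 * s\<^sup>2)"
        unfolding d exp_add[symmetric] by (simp add: algebra_simps)
      thus "1 / 2 * (C * ((1 + 2 / sqrt pi * s) * exp (- d * s\<^sup>2))) =
       1 / 2 * exp (- s\<^sup>2) * (C * ((1 + 2 / sqrt pi * s) * exp (\<rho>\<^sup>2 * s\<^sup>2)))" by (simp add: mult_ac)
    qed
    finally show "((\<lambda>s. 1 / 2 * exp (- s\<^sup>2) * (C * ((1 + 2 / sqrt pi * s) * exp (\<rho>\<^sup>2 * s\<^sup>2)))) \<longlongrightarrow> 0) at_top" .
  qed auto
  from tendsto_add[OF tendsto_mult_right_zero[OF erfc_tendsto_0, of "1/2"] this] show ?thesis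
    by (simp add: nct_G_def[abs_def])
qed

subsection \<open>The asymptotic expansion\<close>

text \<open>Putting s = z / sqrt y merges exp(-s^2) with the exp(z^2) of the moment series, as s^2 -
  z^2 = (1/y - 1) z^2. The normalising factor is chosen so that y enters the derivative only through
  1/y - 1.\<close>

lemma nct_G_rescaled_has_real_derivative:
  fixes q y z :: real
  assumes q: "q > 0" and y: "0 < y" "y < 1" and z: "z \<ge> 1"
  shows "((\<lambda>z. nct_G y q (z / sqrt y) * (Gamma q * sqrt y / (1 - y) powr q)) has_real_derivative
           - (2 * exp (- (1 / y - 1) * z\<^sup>2) * (shifted_gauss_moment (2 * q - 1) z / sqrt pi))) (at z)"
proof -
  define s where "s = z / sqrt y"
  have s: "s * sqrt y = z" "s\<^sup>2 = z\<^sup>2 / y" using y by (auto simp: s_def power_divide)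
  define M where "M = shifted_gauss_moment (2 * q - 1) z"
  obtain S where S: "(\<lambda>k. (2 * z) ^ k / fact k * Gamma (real k / 2 + q)) sums S"
    and D: "(nct_G y q has_real_derivative - (exp (- s\<^sup>2) * (1 - y) powr q / (Gamma q * sqrt pi) * S)) (at s)"
    using nct_G_has_real_derivative[OF q y, of s] unfolding s(1) by blast
  have "(\<lambda>k. (2 * z) ^ k / fact k * Gamma ((real k + (2 * q - 1) + 1) / 2)) sums (2 * exp (z\<^sup>2) * M)"
    unfolding M_def using q z by (intro shifted_gauss_moment_series integrable_shifted_gauss_moment) auto
  hence S_eq: "S = 2 * exp (z\<^sup>2) * M"
    using S by (intro sums_unique2[OF S]) (simp add: add_divide_distrib)
  have "((\<lambda>z. z / sqrt y) has_real_derivative 1 / sqrt y) (at z)"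
    by (rule DERIV_cdivide[OF DERIV_ident])
  from DERIV_chain2[OF D[unfolded s_def] this]
  have "((\<lambda>z. nct_G y q (z / sqrt y)) has_real_derivative
      - (exp (- s\<^sup>2) * (1 - y) powr q / (Gamma q * sqrt pi) * S) * (1 / sqrt y)) (at z)"
    unfolding s_def .
  from DERIV_cmult_right[OF this, of "Gamma q * sqrt y / (1 - y) powr q"]
  have "((\<lambda>z. nct_G y q (z / sqrt y) * (Gamma q * sqrt y / (1 - y) powr q)) has_real_derivative
      - (exp (- s\<^sup>2) * (1 - y) powr q / (Gamma q * sqrt pi) * S) * (1 / sqrt y)
        * (Gamma q * sqrt y / (1 - y) powr q)) (at z)" .
  also have "- (exp (- s\<^sup>2) * (1 - y) powr q / (Gamma q * sqrt pi) * S) * (1 / sqrt y)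
        * (Gamma q * sqrt y / (1 - y) powr q) = - (2 * (exp (- s\<^sup>2) * exp (z\<^sup>2)) * (M / sqrt pi))"
  proof -
    have "Gamma q \<noteq> 0" using Gamma_real_pos[OF q] by linarith
    moreover have "(1 - y) powr q \<noteq> 0" "sqrt y \<noteq> 0" using y by auto
    moreover have "- (e * p / (g * i) * (2 * e' * m)) * (1 / r) * (g * r / p) = - (2 * (e * e') * (m / i))"
      if "g \<noteq> 0" "p \<noteq> 0" "r \<noteq> 0" for e p g i e' m r :: real
      using that by simp
    ultimately show ?thesis unfolding S_eq by blast
  qed
  also have "exp (- s\<^sup>2) * exp (z\<^sup>2) = exp (- (1 / y - 1) * z\<^sup>2)"
    unfolding exp_add[symmetric] s(2) by (simp add: algebra_simps)
  finally show ?thesis unfolding M_def .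
qed

text \<open>The negative derivative of exp(-l w^2) w^r is exp(-l w^2) w^(r-1) (2 l w^2 - r), and r
  \<le> l w^2 leaves at least half of its main term. Hence the explicit constant C/l, which can be
  controlled uniformly in y.\<close>

lemma gaussian_tail_comparison:
  fixes E E' :: "real \<Rightarrow> real" and C r l z\<^sub>0 :: real
  assumes l: "l > 0" and C: "C \<ge> 0" and z0: "z\<^sub>0 > 0" "r \<le> l * z\<^sub>0\<^sup>2"
    and E: "\<And>z. z \<ge> z\<^sub>0 \<Longrightarrow> (E has_real_derivative E' z) (at z)"
    and E': "\<And>z. z \<ge> z\<^sub>0 \<Longrightarrow> \<bar>E' z\<bar> \<le> C * (exp (- l * z\<^sup>2) * z powr (r + 1))"
    and lim: "(E \<longlongrightarrow> 0) at_top"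
    and z: "z \<ge> z\<^sub>0"
  shows "\<bar>E z\<bar> \<le> C / l * (exp (- l * z\<^sup>2) * z powr r)"
proof -
  define g where "g w = exp (- l * w\<^sup>2) * w powr r" for w :: real
  define g' where "g' w = exp (- l * w\<^sup>2) * (r * w powr (r - 1)) - 2 * l * w * exp (- l * w\<^sup>2) * w powr r" for w :: real
  have g: "(g has_real_derivative g' w) (at w)" if "w \<ge> z\<^sub>0" for w
    unfolding g_def g'_def using that z0 by (auto intro!: derivative_eq_intros simp: algebra_simps)
  have g': "C / l * g' w \<le> - (C * (exp (- l * w\<^sup>2) * w powr (r + 1)))" if w: "w \<ge> z\<^sub>0" for w
  proof -
    have w0: "w > 0" using w z0 by simp
    have "l * z\<^sub>0\<^sup>2 \<le> l * w\<^sup>2" using w z0 l by (intro mult_left_mono power_mono) auto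
    hence r: "r \<le> l * w\<^sup>2" using z0 by linarith
    have p: "w powr (r + 1) = w\<^sup>2 * w powr (r - 1)" "w powr r = w * w powr (r - 1)"
      using w0 by (simp_all add: powr_add powr_diff power2_eq_square)
    have "g' w = exp (- l * w\<^sup>2) * w powr (r - 1) * (r - 2 * (l * w\<^sup>2))"
      unfolding g'_def p by (simp add: algebra_simps power2_eq_square)
    also have "\<dots> \<le> exp (- l * w\<^sup>2) * w powr (r - 1) * (- (l * w\<^sup>2))"
      using r by (intro mult_left_mono) auto
    also have "\<dots> = - l * (exp (- l * w\<^sup>2) * w powr (r + 1))" unfolding p by (simp add: algebra_simps)
    finally have "C / l * g' w \<le> C / l * (- l * (exp (- l * w\<^sup>2) * w powr (r + 1)))"
      using C l by (intro mult_left_mono) auto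
    thus ?thesis using l by simp
  qed
  have g_lim: "(g \<longlongrightarrow> 0) at_top" unfolding g_def using l by real_asymp
  \<comment> \<open>Both functions \<open>\<plusminus>E + (C/l) g\<close> decrease to 0 and hence are nonnegative.\<close>
  have key: "0 \<le> \<sigma> * E z + C / l * g z" if \<sigma>: "\<bar>\<sigma>\<bar> = 1" for \<sigma>
  proof (rule tendsto_upperbound)
    show "((\<lambda>w. \<sigma> * E w + C / l * g w) \<longlongrightarrow> 0) at_top"
      using tendsto_add[OF tendsto_mult_right_zero[OF lim, of \<sigma>]
          tendsto_mult_right_zero[OF g_lim, of "C / l"]] by simp
    show "\<forall>\<^sub>F w in at_top. \<sigma> * E w + C / l * g w \<le> \<sigma> * E z + C / l * g z"
      using eventually_ge_at_top[of z]
    proof eventually_elim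
      case (elim w)
      show ?case
      proof (rule DERIV_nonpos_imp_nonincreasing[OF elim])
        fix x assume x: "z \<le> x" "x \<le> w"
        have "((\<lambda>w. \<sigma> * E w + C / l * g w) has_real_derivative \<sigma> * E' x + C / l * g' x) (at x)"
          using x z by (intro DERIV_add DERIV_cmult E g) auto
        moreover have "\<sigma> * E' x \<le> \<bar>E' x\<bar>" using \<sigma> by (metis abs_ge_self abs_mult mult_1)
        hence "\<sigma> * E' x + C / l * g' x \<le> 0" using E'[of x] g'[of x] x z by linarith
        ultimately show "\<exists>d. ((\<lambda>w. \<sigma> * E w + C / l * g w) has_real_derivative d) (at x) \<and> d \<le> 0" by blast
      qed
    qed
  qed auto
  from key[of 1] key[of "-1"] show ?thesis unfolding g_def by auto
qed

text \<open>Differentiating term k gives l h_k at the power 2q-1-2k and a second piece that lands on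
  the next power with P_(k+1). There l h_(k+1) - h_k = b_(k+1) joins it to the following term, and
  only the last second piece is left over.\<close>

lemma exp_powr_sum_has_real_derivative:
  fixes h b :: "nat \<Rightarrow> real" and l q z :: real
  assumes rec: "\<And>k. l * h k = b k + (case k of 0 \<Rightarrow> 0 | Suc j \<Rightarrow> h j)" and z: "z > 0"
  defines "P \<equiv> \<lambda>k. (- 1) ^ k * pochhammer (1 - q) k"
  shows "((\<lambda>z. exp (- l * z\<^sup>2) * (\<Sum>k<N. h k * P k * z powr (2 * q - 2 - 2 * real k))) has_real_derivative
     - (2 * exp (- l * z\<^sup>2) * ((\<Sum>k<N. b k * P k * z powr (2 * q - 1 - 2 * real k))
         - (case N of 0 \<Rightarrow> 0 | Suc j \<Rightarrow> h j) * P N * z powr (2 * q - 1 - 2 * real N)))) (at z)"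
proof (induction N)
  case (Suc N)
  define e where "e = 2 * q - 2 - 2 * real N"
  define X where "X = exp (- l * z\<^sup>2)"
  have half: "q - 1 - real N = e / 2" by (simp add: e_def)
  have pow: "z powr (e + 1) = z * z powr e" using z by (simp add: powr_add)
  have P: "P (Suc N) = P N * (q - 1 - real N)"
    by (simp add: P_def pochhammer_Suc algebra_simps)
  have "((\<lambda>z. exp (- l * z\<^sup>2) * z powr e) has_real_derivative
      exp (- l * z\<^sup>2) * (- l * (2 * z)) * z powr e + exp (- l * z\<^sup>2) * (e * z powr (e - 1))) (at z)"
    using z by (auto intro!: derivative_eq_intros simp: algebra_simps)
  also have "exp (- l * z\<^sup>2) * (- l * (2 * z)) * z powr e + exp (- l * z\<^sup>2) * (e * z powr (e - 1)) =
      - (2 * X * (l * z powr (e + 1) - (q - 1 - real N) * z powr (e - 1)))"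
    unfolding half pow X_def by (simp add: algebra_simps)
  finally have "((\<lambda>z. h N * P N * (exp (- l * z\<^sup>2) * z powr e)) has_real_derivative
      h N * P N * (- (2 * X * (l * z powr (e + 1) - (q - 1 - real N) * z powr (e - 1))))) (at z)"
    by (rule DERIV_cmult)
  from DERIV_add[OF Suc.IH this]
  have D: "((\<lambda>z. exp (- l * z\<^sup>2) * (\<Sum>k<Suc N. h k * P k * z powr (2 * q - 2 - 2 * real k))) has_real_derivative
     - (2 * X * ((\<Sum>k<N. b k * P k * z powr (2 * q - 1 - 2 * real k))
         - (case N of 0 \<Rightarrow> 0 | Suc j \<Rightarrow> h j) * P N * z powr (2 * q - 1 - 2 * real N))) +
     h N * P N * (- (2 * X * (l * z powr (e + 1) - (q - 1 - real N) * z powr (e - 1))))) (at z)"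
    by (simp add: X_def e_def algebra_simps)
  have e: "2 * q - 1 - 2 * real N = e + 1" "2 * q - 1 - 2 * real (Suc N) = e - 1" by (simp_all add: e_def)
  have hl: "(case N of 0 \<Rightarrow> 0 | Suc j \<Rightarrow> h j) = l * h N - b N" using rec[of N] by simp
  show ?case
    by (rule DERIV_cong[OF D]) (unfold sum.lessThan_Suc e hl P X_def nat.case, simp add: algebra_simps)
qed auto

theorem theorem5p1:
  fixes n :: real and c :: "real \<Rightarrow> nat \<Rightarrow> real"
  assumes n: "n > 0"
    and c: "\<And>y. 0 < y \<Longrightarrow> y < 1 \<Longrightarrow>
      \<exists>r>0. \<forall>t. \<bar>t\<bar> < r \<longrightarrow>
        (\<lambda>k. c y k * t ^ k) sums ((1 + t) powr (n / 2 - 1 / 2) / (1 - y * (t + 1)))"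
  shows
    "(\<forall>\<epsilon> N. 0 < \<epsilon> \<and> \<epsilon> < 1 / 2 \<longrightarrow>
       (\<exists>C Z. \<forall>x \<delta> y \<zeta>.
          x > 0 \<and> \<delta> > 0 \<and> y = nct_y n x \<and> \<zeta> = 1 / 2 * \<delta>\<^sup>2 * y \<and>
          \<epsilon> \<le> y \<and> y \<le> 1 - \<epsilon> \<and> \<zeta> \<ge> Z \<longrightarrow>
          (\<exists>R. \<bar>R\<bar> \<le> C / \<zeta> ^ N \<and>
             nct_F n x \<delta> =
               exp (- (1 / 2 * (1 - y) * \<delta>\<^sup>2)) * sqrt y * (1 - y) powr (n / 2)
                 * \<zeta> powr (n / 2 - 1) / Gamma (n / 2) *
               ((\<Sum>k<N. (- 1) ^ k * pochhammer (1 - n / 2) k * (c y k / \<zeta> ^ k)) + R))))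
     \<and> (\<forall>m::nat. m \<ge> 1 \<and> n = 2 * real m \<longrightarrow>
         (\<forall>x \<delta> y \<zeta>. x > 0 \<and> \<delta> > 0 \<and> y = nct_y n x \<and> \<zeta> = 1 / 2 * \<delta>\<^sup>2 * y \<longrightarrow>
            (\<forall>k\<ge>m. (- 1) ^ k * pochhammer (1 - n / 2) k * (c y k / \<zeta> ^ k) = 0)))"
proof (intro conjI allI impI)
  fix \<epsilon> :: real and N :: nat
  assume "0 < \<epsilon> \<and> \<epsilon> < 1 / 2"
  hence \<epsilon>: "0 < \<epsilon>" "\<epsilon> < 1 / 2" by auto
  define q where "q = n / 2"
  have q: "q > 0" using n by (simp add: q_def)
  define P where "P k = (- 1) ^ k * pochhammer (1 - q) k" for k :: nat
  define b where "b k = (q - 1 / 2) gchoose k" for k :: nat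
  have rec: "(1 - y) * c y k = b k + (case k of 0 \<Rightarrow> 0 | Suc j \<Rightarrow> y * c y j)" if y: "0 < y" "y < 1" for y k
  proof -
    obtain r where "r > 0" "\<And>t. \<bar>t\<bar> < r \<Longrightarrow>
        (\<lambda>k. c y k * t ^ k) sums ((1 + t) powr (q - 1 / 2) / (1 - y * (t + 1)))"
      using c[OF y] unfolding q_def by blast
    from quotient_powser_recurrence[OF y this] show ?thesis unfolding b_def .
  qed
  \<comment> \<open>Only c_(N-1) enters the left-over term of the telescoped derivative. For N = 0
    the index is truncated to 0; the left-over is then 0, and just B \<ge> 0 is used.\<close>
  obtain B where B: "\<And>y. \<epsilon> \<le> y \<Longrightarrow> y \<le> 1 - \<epsilon> \<Longrightarrow> \<bar>c y (N - 1)\<bar> \<le> B"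
    using recurrence_uniformly_bounded[OF \<epsilon>(1) rec] by blast
  have "\<bar>c \<epsilon> (N - 1)\<bar> \<le> B" using \<epsilon> by (intro B) auto
  hence B0: "B \<ge> 0" by linarith
  obtain C where C: "\<And>z. z \<ge> 1 \<Longrightarrow> \<bar>shifted_gauss_moment (2 * q - 1) z -
      sqrt pi * (\<Sum>k<N. b k * P k * z powr (2 * q - 1 - 2 * real k))\<bar> \<le> C * z powr (2 * q - 1 - 2 * real N)"
    using shifted_gauss_moment_asymptotics[OF q, of N] unfolding b_def P_def by blast
  have C0: "C \<ge> 0" using C[of 1] by simp
  define r where "r = 2 * q - 2 - 2 * real N"
  \<comment> \<open>The first summand is the Laplace error, the second the left-over term; the 2 is
    the common factor of both derivatives.\<close>
  define K where "K = 2 * (C / sqrt pi + B * \<bar>P N\<bar>)"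
  have K0: "K \<ge> 0" using B0 C0 by (simp add: K_def)
  \<comment> \<open>Since z0 \<ge> 1, |r|/\<epsilon> \<le> z0 \<le> z0^2, so the condition on r in
    the comparison holds for every l \<ge> \<epsilon> at once.\<close>
  define z\<^sub>0 where "z\<^sub>0 = max 1 (\<bar>r\<bar> / \<epsilon>)"
  have z0: "z\<^sub>0 \<ge> 1" by (simp add: z\<^sub>0_def)
  have rz0: "\<bar>r\<bar> \<le> \<epsilon> * z\<^sub>0\<^sup>2"
  proof -
    have "\<bar>r\<bar> / \<epsilon> \<le> z\<^sub>0" by (simp add: z\<^sub>0_def)
    also have "z\<^sub>0 * 1 \<le> z\<^sub>0 * z\<^sub>0" using z0 by (intro mult_left_mono) auto
    finally show ?thesis using \<epsilon> by (simp add: field_simps power2_eq_square)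
  qed
  \<comment> \<open>One division by \<epsilon> comes from 1/l \<le> 1/\<epsilon>, the other from y
    \<ge> \<epsilon> when the error is taken relative to the prefactor.\<close>
  have main: "\<exists>R. \<bar>R\<bar> \<le> K / \<epsilon> / \<epsilon> / \<zeta> ^ N \<and> nct_F n x \<delta> =
               exp (- (1 / 2 * (1 - y) * \<delta>\<^sup>2)) * sqrt y * (1 - y) powr q * \<zeta> powr (q - 1) / Gamma q *
               ((\<Sum>k<N. P k * (c y k / \<zeta> ^ k)) + R)"
    if h: "\<delta> > 0" "y = nct_y n x" "\<zeta> = 1 / 2 * \<delta>\<^sup>2 * y" "\<epsilon> \<le> y" "y \<le> 1 - \<epsilon>" "\<zeta> \<ge> z\<^sub>0\<^sup>2" for x \<delta> y \<zeta>
  proof -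
    have y: "0 < y" "y < 1" using h \<epsilon> by auto
    define l where "l = 1 / y - 1"
    have "\<epsilon> * y \<le> 1 * (1 - y)" using h \<epsilon> y
      by (smt (verit) mult_left_le)
    hence l: "\<epsilon> \<le> l" "l > 0" using y by (simp_all add: l_def field_simps)
    \<comment> \<open>As l = (1 - y)/y, multiplying c_k by y turns the recurrence into the
      telescoping form l h_k - h_(k-1) = b_k.\<close>
    define h' where "h' k = y * c y k" for k
    have rec': "l * h' k = b k + (case k of 0 \<Rightarrow> 0 | Suc j \<Rightarrow> h' j)" for k
    proof -
      have "l * h' k = (1 - y) * c y k" using y by (simp add: l_def h'_def field_simps)
      thus ?thesis unfolding rec[OF y] h'_def .
    qed
    define A where "A z = nct_G y q (z / sqrt y) * (Gamma q * sqrt y / (1 - y) powr q)" for z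
    define T where "T z = exp (- l * z\<^sup>2) * (\<Sum>k<N. h' k * P k * z powr (2 * q - 2 - 2 * real k))" for z
    define M where "M z = shifted_gauss_moment (2 * q - 1) z" for z
    define \<Sigma> where "\<Sigma> z = (\<Sum>k<N. b k * P k * z powr (2 * q - 1 - 2 * real k))" for z
    define hN where "hN = (case N of 0 \<Rightarrow> 0 | Suc j \<Rightarrow> h' j)"
    have hN: "\<bar>hN\<bar> \<le> B"
    proof (cases N)
      case (Suc j)
      have "y * \<bar>c y j\<bar> \<le> 1 * B" using B[OF h(4,5)] Suc y by (intro mult_mono) auto
      thus ?thesis using Suc y by (simp add: hN_def h'_def abs_mult)
    qed (use B0 in \<open>simp add: hN_def\<close>)
    have dA: "(A has_real_derivative - (2 * exp (- l * z\<^sup>2) * (M z / sqrt pi))) (at z)" if "z \<ge> 1" for z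
      unfolding A_def M_def l_def by (rule nct_G_rescaled_has_real_derivative[OF q y that])
    have dT: "(T has_real_derivative - (2 * exp (- l * z\<^sup>2) *
        (\<Sigma> z - hN * P N * z powr (2 * q - 1 - 2 * real N)))) (at z)" if "z \<ge> 1" for z
      unfolding T_def P_def \<Sigma>_def hN_def
      by (rule exp_powr_sum_has_real_derivative[OF rec']) (use that in auto)
    define E where "E z = A z - T z" for z
    have bound: "\<bar>E z\<bar> \<le> K / l * (exp (- l * z\<^sup>2) * z powr r)" if z: "z \<ge> z\<^sub>0" for z
    proof (rule gaussian_tail_comparison[OF l(2) K0 _ _ _ _ _ z])
      show "z\<^sub>0 > 0" using z0 by simp
      have "\<epsilon> * z\<^sub>0\<^sup>2 \<le> l * z\<^sub>0\<^sup>2" using l by (intro mult_right_mono) auto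
      thus "r \<le> l * z\<^sub>0\<^sup>2" using rz0 by linarith
    next
      fix z assume z: "z \<ge> z\<^sub>0"
      hence z1: "z \<ge> 1" using z0 by simp
      show "(E has_real_derivative (- (2 * exp (- l * z\<^sup>2) * (M z / sqrt pi)) -
          - (2 * exp (- l * z\<^sup>2) * (\<Sigma> z - hN * P N * z powr (2 * q - 1 - 2 * real N))))) (at z)"
        unfolding E_def by (intro DERIV_diff dA dT z1)
      have r1: "2 * q - 1 - 2 * real N = r + 1" by (simp add: r_def)
      have "M z / sqrt pi - \<Sigma> z = (M z - sqrt pi * \<Sigma> z) / sqrt pi"
        by (simp add: diff_divide_distrib)
      hence "\<bar>M z / sqrt pi - \<Sigma> z\<bar> = \<bar>M z - sqrt pi * \<Sigma> z\<bar> / sqrt pi"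
        by (simp only: abs_divide) simp
      also have "\<dots> \<le> C * z powr (r + 1) / sqrt pi"
        using C[OF z1] unfolding M_def \<Sigma>_def r1 by (intro divide_right_mono) auto
      finally have 1: "\<bar>M z / sqrt pi - \<Sigma> z\<bar> \<le> C * z powr (r + 1) / sqrt pi" .
      have 2: "\<bar>hN * P N * z powr (r + 1)\<bar> \<le> B * \<bar>P N\<bar> * z powr (r + 1)"
        using hN by (simp add: abs_mult mult_right_mono)
      have "\<bar>- (2 * exp (- l * z\<^sup>2) * (M z / sqrt pi)) - - (2 * exp (- l * z\<^sup>2) * (\<Sigma> z - hN * P N * z powr (r + 1)))\<bar>
        = \<bar>2 * exp (- l * z\<^sup>2) * (- (M z / sqrt pi - \<Sigma> z) - hN * P N * z powr (r + 1))\<bar>"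
        by (rule arg_cong[of _ _ abs]) (simp add: algebra_simps)
      also have "\<dots> = 2 * exp (- l * z\<^sup>2) * \<bar>- (M z / sqrt pi - \<Sigma> z) - hN * P N * z powr (r + 1)\<bar>"
        by (simp add: abs_mult)
      also have "\<dots> \<le> 2 * exp (- l * z\<^sup>2) * (C * z powr (r + 1) / sqrt pi + B * \<bar>P N\<bar> * z powr (r + 1))"
        using 1 2 by (intro mult_left_mono) auto
      also have "\<dots> = K * (exp (- l * z\<^sup>2) * z powr (r + 1))"
        by (simp add: K_def algebra_simps)
      finally show "\<bar>- (2 * exp (- l * z\<^sup>2) * (M z / sqrt pi)) - - (2 * exp (- l * z\<^sup>2) *
          (\<Sigma> z - hN * P N * z powr (2 * q - 1 - 2 * real N)))\<bar> \<le> K * (exp (- l * z\<^sup>2) * z powr (r + 1))"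
        unfolding r1 .
    next
      have "filterlim (\<lambda>z. z / sqrt y) at_top at_top" using y by real_asymp
      from filterlim_compose[OF nct_G_tendsto_0[OF q y] this]
      have "(A \<longlongrightarrow> 0) at_top" unfolding A_def by (rule tendsto_mult_left_zero)
      moreover have "(T \<longlongrightarrow> 0) at_top"
      proof -
        have "((\<lambda>z. exp (- l * z\<^sup>2) * z powr (2 * q - 2 - 2 * real k)) \<longlongrightarrow> 0) at_top" for k
          using l(2) by real_asymp
        hence "((\<lambda>z. \<Sum>k<N. h' k * P k * (exp (- l * z\<^sup>2) * z powr (2 * q - 2 - 2 * real k))) \<longlongrightarrow> 0) at_top"
          by (intro tendsto_null_sum tendsto_mult_right_zero)
        thus ?thesis unfolding T_def sum_distrib_left by (simp add: mult_ac)
      qed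
      ultimately show "(E \<longlongrightarrow> 0) at_top" unfolding E_def using tendsto_diff by force
    qed
    define z where "z = sqrt \<zeta>"
    have "z\<^sub>0 \<le> z" unfolding z_def using h(6) z0 by (simp add: real_le_rsqrt)
    hence zz: "z \<ge> z\<^sub>0" "z \<ge> 1" "z > 0" using z0 by auto
    have \<zeta>0: "\<zeta> > 0" using zz by (simp add: z_def)
    have z2: "z\<^sup>2 = \<zeta>" using \<zeta>0 by (simp add: z_def)
    have zpow: "z powr (2 * q - 2 - 2 * real k) = \<zeta> powr (q - 1) / \<zeta> ^ k" for k
    proof -
      have "z powr (2 * q - 2 - 2 * real k) = z powr (2 * (q - 1 - real k))" by (simp add: algebra_simps)
      also have "\<dots> = \<zeta> powr (q - 1 - real k)"
        using zz powr_powr[of z 2 "q - 1 - real k"] z2 by simp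
      finally show ?thesis using \<zeta>0 by (simp add: powr_diff powr_realpow)
    qed
    have sy: "sqrt y > 0" using y by simp
    have "z / sqrt y = \<delta> / sqrt 2"
      unfolding z_def h(3) using h(1) y by (simp add: real_sqrt_mult real_sqrt_divide)
    hence F: "nct_F n x \<delta> = nct_G y q (z / sqrt y)"
      using nct_F_eq_nct_G[OF n h(1), of x] y unfolding h(2)[symmetric] q_def by simp
    have Gq: "Gamma q > 0" using q by (rule Gamma_real_pos)
    have yq: "(1 - y) powr q > 0" using y by simp
    define X where "X = exp (- l * \<zeta>) * \<zeta> powr (q - 1)"
    have X: "X > 0" using \<zeta>0 by (simp add: X_def)
    have expo: "exp (- l * \<zeta>) = exp (- (1 / 2 * (1 - y) * \<delta>\<^sup>2))"
      unfolding h(3) l_def using y by (simp add: field_simps)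
    have T: "T z = y * X * (\<Sum>k<N. P k * (c y k / \<zeta> ^ k))"
      unfolding T_def z2 zpow X_def h'_def sum_distrib_left by (intro sum.cong refl) (simp add: mult_ac)
    define R where "R = E z / (y * X)"
    have ER: "E z = y * X * R" using y X by (simp add: R_def)
    have "nct_F n x \<delta> = A z * ((1 - y) powr q / (Gamma q * sqrt y))"
      unfolding F A_def using Gq yq sy by simp
    also have "A z = y * X * ((\<Sum>k<N. P k * (c y k / \<zeta> ^ k)) + R)"
      using T ER unfolding E_def by (simp add: algebra_simps)
    also have "y * X * ((\<Sum>k<N. P k * (c y k / \<zeta> ^ k)) + R) * ((1 - y) powr q / (Gamma q * sqrt y)) =
      exp (- l * \<zeta>) * (y / sqrt y) * (1 - y) powr q * \<zeta> powr (q - 1) / Gamma q *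
        ((\<Sum>k<N. P k * (c y k / \<zeta> ^ k)) + R)"
      unfolding X_def by (simp add: mult_ac)
    also have "y / sqrt y = sqrt y" using y by (simp add: real_div_sqrt)
    finally have eq: "nct_F n x \<delta> = exp (- (1 / 2 * (1 - y) * \<delta>\<^sup>2)) * sqrt y * (1 - y) powr q *
        \<zeta> powr (q - 1) / Gamma q * ((\<Sum>k<N. P k * (c y k / \<zeta> ^ k)) + R)"
      unfolding expo .
    have "\<bar>E z\<bar> \<le> K / l * (exp (- l * z\<^sup>2) * z powr r)" by (rule bound[OF zz(1)])
    also have "exp (- l * z\<^sup>2) * z powr r = X / \<zeta> ^ N" unfolding r_def zpow X_def z2 by simp
    also have "K / l * (X / \<zeta> ^ N) \<le> K / \<epsilon> * (X / \<zeta> ^ N)"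
      using l \<epsilon> K0 X \<zeta>0 by (intro mult_right_mono divide_left_mono) auto
    finally have "\<bar>E z\<bar> / (y * X) \<le> K / \<epsilon> * (X / \<zeta> ^ N) / (\<epsilon> * X)"
      using h(4) \<epsilon> X \<zeta>0 K0 y by (intro frac_le mult_right_mono mult_nonneg_nonneg) auto
    also have "\<dots> = K / \<epsilon> / \<epsilon> / \<zeta> ^ N" using X by (simp add: field_simps)
    finally have "\<bar>R\<bar> \<le> K / \<epsilon> / \<epsilon> / \<zeta> ^ N" using X y by (simp add: R_def abs_divide abs_mult)
    with eq show ?thesis by blast
  qed
  show "\<exists>C Z. \<forall>x \<delta> y \<zeta>.
          x > 0 \<and> \<delta> > 0 \<and> y = nct_y n x \<and> \<zeta> = 1 / 2 * \<delta>\<^sup>2 * y \<and>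
          \<epsilon> \<le> y \<and> y \<le> 1 - \<epsilon> \<and> \<zeta> \<ge> Z \<longrightarrow>
          (\<exists>R. \<bar>R\<bar> \<le> C / \<zeta> ^ N \<and>
             nct_F n x \<delta> =
               exp (- (1 / 2 * (1 - y) * \<delta>\<^sup>2)) * sqrt y * (1 - y) powr (n / 2)
                 * \<zeta> powr (n / 2 - 1) / Gamma (n / 2) *
               ((\<Sum>k<N. (- 1) ^ k * pochhammer (1 - n / 2) k * (c y k / \<zeta> ^ k)) + R))"
    using main unfolding P_def q_def by blast
next
  fix m :: nat and x \<delta> y \<zeta> :: real and k :: nat
  assume "m \<ge> 1 \<and> n = 2 * real m" and k: "m \<le> k"
  hence m: "m \<ge> 1" "n / 2 = real m" by auto
  \<comment> \<open>The Pochhammer symbol starts at the nonpositive integer -(m-1), so from index m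
    on it contains the factor 0.\<close>
  have "1 - n / 2 = - of_nat (m - 1)" using m by (simp add: of_nat_diff)
  hence "pochhammer (1 - n / 2) k = 0"
    using k m by (simp only: pochhammer_of_nat_eq_0_iff)
  thus "(- 1) ^ k * pochhammer (1 - n / 2) k * (c y k / \<zeta> ^ k) = 0" by simp
qed

end
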